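(* Let $d\ge 2$, $1\le m<d$, $\delta\in(0,1)$, and let $f(\boldsymbol{x})=\mathbf{W}^\top\boldsymbol{x}+\boldsymbol{b}$ be an $L$-class affine classifier on $\mathbb{R}^d$, with $\mathbf{W}=[\boldsymbol{w}_1\,\cdots\,\boldsymbol{w}_L]\in\mathbb{R}^{d\times L}$ and $\boldsymbol{b}\in\mathbb{R}^L$. Fix $\boldsymbol{x}_0\in\mathbb{R}^d$ with $f_{\hat k}(\boldsymbol{x}_0)>f_k(\boldsymbol{x}_0)$ for all $k\neq\hat k$, and assume $\boldsymbol{w}_k\neq\boldsymbol{w}_{\hat k}$ for all $k\neq\hat k$. Let $\mathcal{S}$ be a random $m$-dimensional subspace of $\mathbb{R}^d$. Then, with probability at least $1-2(L+1)\delta$, $$\sqrt{\zeta_1(m,\delta)}\sqrt{\tfrac{d}{m}}\,\|\boldsymbol{r}^*\|_2\;\le\;\|\boldsymbol{r}^*_{\mathcal S}\|_2\;\le\;\sqrt{\zeta_2(m,\delta)}\sqrt{\tfrac{d}{m}}\,\|\boldsymbol{r}^*\|_2 .$$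
   Context: For an $L$-class classifier $f=(f_1,\dots,f_L):\mathbb{R}^d\to\mathbb{R}^L$ and a point $\boldsymbol{x}_0$ with estimated label $\hat k=\arg\max_k f_k(\boldsymbol{x}_0)$, and for a linear subspace $\mathcal{S}\subseteq\mathbb{R}^d$ and $k\neq\hat k$, define $\|\boldsymbol{r}^k_{\mathcal S}\|_2=\inf\{\|\boldsymbol{r}\|_2:\boldsymbol{r}\in\mathcal{S},\ f_k(\boldsymbol{x}_0+\boldsymbol{r})\ge f_{\hat k}(\boldsymbol{x}_0+\boldsymbol{r})\}$ (with $\inf\emptyset=+\infty$), $\|\boldsymbol{r}^k\|_2:=\|\boldsymbol{r}^k_{\mathbb{R}^d}\|_2$, $\|\boldsymbol{r}^*_{\mathcal S}\|_2=\min_{k\neq\hat k}\|\boldsymbol{r}^k_{\mathcal S}\|_2$ and $\|\boldsymbol{r}^*\|_2=\min_{k\neq\hat k}\|\boldsymbol{r}^k\|_2$ (the minimal norm of a perturbation in $\mathcal S$, resp. in $\mathbb{R}^d$, that changes the estimated label; points exactly on the boundary count as label changes). A random $m$-dimensional subspace of $\mathbb{R}^d$ is the span of $m$ independent vectors drawn uniformly from the unit sphere $\mathbb{S}^{d-1}$. For $m\ge1$ and $\delta\in(0,1)$, $\zeta_1(m,\delta)=\Big(1+2\sqrt{\tfrac{\ln(1/\delta)}{m}}+\tfrac{2\ln(1/\delta)}{m}\Big)^{-1}$ and $\zeta_2(m,\delta)=\Big(\max\big(\tfrac1e\delta^{2/m},\,1-\sqrt{2(1-\delta^{2/m})}\big)\Big)^{-1}$.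 *)

theory Defs
  imports "HOL-Analysis.Analysis" "HOL-Probability.Probability"
begin

text \<open>Uniform (normalized surface) measure on the unit sphere of real^'n:
  the image of the uniform distribution on the open unit ball under x \<mapsto> x/|x|
  (the cone-measure construction of the rotation-invariant probability measure).\<close>
definition unif_sphere :: "(real^'n) measure" where
  "unif_sphere = distr (uniform_measure lborel (ball 0 1)) borel (\<lambda>x. x /\<^sub>R norm x)"

definition rand_dirs :: "nat \<Rightarrow> (nat \<Rightarrow> real^'n) measure" where
  "rand_dirs m = PiM {..<m} (\<lambda>_. unif_sphere)"

definition affine_clf :: "(nat \<Rightarrow> real^'n) \<Rightarrow> (nat \<Rightarrow> real) \<Rightarrow> nat \<Rightarrow> real^'n \<Rightarrow> real" where
  "affine_clf W b k x = W k \<bullet> x + b k"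

text \<open>Minimal norm of a perturbation in S moving x0 to the region where f_k \<ge> f_khat
  (Inf of the empty set is +\<infinity>).\<close>
definition rk_S :: "(nat \<Rightarrow> 'a::real_normed_vector \<Rightarrow> real) \<Rightarrow> 'a set \<Rightarrow> 'a \<Rightarrow> nat \<Rightarrow> nat \<Rightarrow> ereal" where
  "rk_S f S x0 khat k = Inf {ereal (norm r) | r. r \<in> S \<and> f k (x0 + r) \<ge> f khat (x0 + r)}"

definition rstar_S :: "(nat \<Rightarrow> 'a::real_normed_vector \<Rightarrow> real) \<Rightarrow> nat \<Rightarrow> 'a set \<Rightarrow> 'a \<Rightarrow> nat \<Rightarrow> ereal" where
  "rstar_S f L S x0 khat = (INF k \<in> {..<L} - {khat}. rk_S f S x0 khat k)"

definition zeta1 :: "nat \<Rightarrow> real \<Rightarrow> real" where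
  "zeta1 m \<delta> = inverse (1 + 2 * sqrt (ln (1/\<delta>) / real m) + 2 * ln (1/\<delta>) / real m)"

definition zeta2 :: "nat \<Rightarrow> real \<Rightarrow> real" where
  "zeta2 m \<delta> = inverse (max ((1 / exp 1) * \<delta> powr (2 / real m))
                             (1 - sqrt (2 * (1 - \<delta> powr (2 / real m)))))"

end

theory Submission
  imports Defs
begin

text \<open>
  For \<open>z = w\<^sub>k - w\<^bsub>khat\<^esub>\<close> the minimal perturbation inside a subspace \<open>S\<close> that reaches class \<open>k\<close> is larger than the
  unrestricted one by the factor \<open>norm z / norm (P\<^sub>S z)\<close>, so the claim is a two-sided tail bound for the
  length of the projection of a fixed vector to a random \<open>m\<close>-dimensional subspace.
  By rotation invariance one may instead project a uniformly random direction to a fixed coordinate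
  subspace. There the cone \<open>C\<close> of directions whose projection is too short (or too long) satisfies
  \<open>D (C \<inter> B) \<subseteq> B\<close> for the unit ball \<open>B\<close> and a suitable diagonal map \<open>D\<close>, so that its probability
  \<open>vol (C \<inter> B) / vol B\<close> is at most \<open>1 / det D\<close>. For the threshold \<open>\<beta> m / d\<close> on the squared length the
  optimal \<open>D\<close> gives \<open>exp (m / 2 * (1 - \<beta> + ln \<beta>))\<close>, which is at most \<open>\<delta>\<close> for \<open>\<beta> = 1 / \<zeta>\<^sub>1\<close> and
  \<open>\<beta> = 1 / \<zeta>\<^sub>2\<close>. A union bound over the classes finishes the proof.
\<close>

section \<open>Rotation invariance of Lebesgue measure\<close>

lemma nn_integral_lborel_translate:
  fixes c :: "'a::euclidean_space"
  assumes [measurable]: "f \<in> borel_measurable borel"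
  shows "(\<integral>\<^sup>+x. f (c + x) \<partial>lborel) = (\<integral>\<^sup>+x. f x \<partial>lborel)"
proof -
  have "(\<integral>\<^sup>+x. f x \<partial>lborel) = (\<integral>\<^sup>+x. f x \<partial>distr lborel borel ((+) c))"
    by (simp add: lborel_distr_plus)
  then show ?thesis by (simp add: nn_integral_distr)
qed

lemma borel_measurable_orthogonal_transformation:
  fixes T :: "'a::euclidean_space \<Rightarrow> 'a"
  assumes "orthogonal_transformation T"
  shows "T \<in> borel_measurable borel"
  using assms
  by (intro borel_measurable_continuous_onI linear_continuous_on)
     (simp add: orthogonal_transformation_linear linear_conv_bounded_linear[symmetric])

text \<open>Fubini for the joint condition \<open>x \<in> ball 0 1\<close> and
  \<open>T y + x \<in> B\<close>. Integrating over \<open>y\<close> first gives the ball volume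
  times the image measure of \<open>B\<close>, because a shift of \<open>T y\<close> comes from a
  shift of \<open>y\<close>. Replacing \<open>x\<close> by \<open>x - T y\<close> first gives the
  ball volume times the Lebesgue measure of \<open>B\<close>, because \<open>T\<close> is an
  isometry onto the space. The ball volume is positive and finite, hence cancels.\<close>

lemma lborel_distr_orthogonal_transformation:
  fixes T :: "'a::euclidean_space \<Rightarrow> 'a"
  assumes T: "orthogonal_transformation T"
  shows "distr lborel borel T = lborel"
proof (rule measure_eqI)
  have lin: "linear T" by (rule orthogonal_transformation_linear[OF T])
  note [measurable] = borel_measurable_orthogonal_transformation[OF T]
  fix B assume "B \<in> sets (distr lborel borel T)"
  then have [measurable]: "B \<in> sets borel" by simp
  let ?A = "ball 0 1 :: 'a set"
  let ?I = "\<lambda>x y. indicator ?A x * indicator B (T y + x) :: ennreal"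
  have [simp, measurable]: "(indicator ?A :: 'a \<Rightarrow> ennreal) \<in> borel_measurable borel"
    by (intro borel_measurable_indicator borel_open open_ball)
  have pre: "emeasure (distr lborel borel T) B = (\<integral>\<^sup>+y. indicator B (T y) \<partial>lborel)"
    using nn_integral_distr[of T lborel borel "indicator B"] by simp
  have inner: "(\<integral>\<^sup>+y. indicator B (T y + x) \<partial>lborel) = emeasure (distr lborel borel T) B" for x
  proof -
    obtain x' where x': "T x' = x"
      using orthogonal_transformation_surj[OF T] by (metis surj_def)
    have "(\<integral>\<^sup>+y. indicator B (T y + x) \<partial>lborel) = (\<integral>\<^sup>+y. indicator B (T (x' + y)) \<partial>lborel)"
      by (simp add: x' linear_add[OF lin] add.commute)
    also have "\<dots> = (\<integral>\<^sup>+y. indicator B (T y) \<partial>lborel)"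
      by (rule nn_integral_lborel_translate[where f="\<lambda>y. indicator B (T y)"]) measurable
    finally show ?thesis by (simp add: pre)
  qed
  have ball: "(\<integral>\<^sup>+y. indicator ?A (x - T y) \<partial>lborel) = emeasure lborel ?A" for x
  proof -
    obtain x' where x': "T x' = x"
      using orthogonal_transformation_surj[OF T] by (metis surj_def)
    have "indicator ?A (x - T y) = (indicator ?A (- x' + y) :: ennreal)" for y
    proof -
      have "x - T y = T (x' - y)" by (simp add: x' linear_diff[OF lin])
      then have "norm (x - T y) = norm (- x' + y)"
        by (simp add: orthogonal_transformation_norm[OF T] norm_minus_commute)
      then show ?thesis by (simp add: indicator_def)
    qed
    then show ?thesis
      using nn_integral_lborel_translate[of "indicator ?A" "- x'"] by simp
  qed
  have "emeasure lborel ?A * emeasure (distr lborel borel T) B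
      = (\<integral>\<^sup>+x. \<integral>\<^sup>+y. ?I x y \<partial>lborel \<partial>lborel)"
    by (simp add: nn_integral_cmult inner nn_integral_multc)
  also have "\<dots> = (\<integral>\<^sup>+y. \<integral>\<^sup>+x. ?I x y \<partial>lborel \<partial>lborel)"
    by (intro lborel_pair.Fubini' ) measurable
  \<comment> \<open>For fixed \<open>y\<close>, translating \<open>x\<close> by \<open>T y\<close>
    moves the dependence on \<open>T\<close> from \<open>B\<close> to the ball.\<close>
  also have "\<dots> = (\<integral>\<^sup>+y. \<integral>\<^sup>+x. indicator ?A (x - T y) * indicator B x \<partial>lborel \<partial>lborel)"
  proof (rule nn_integral_cong)
    fix y
    have "(\<integral>\<^sup>+x. indicator ?A (x - T y) * indicator B x \<partial>lborel)
        = (\<integral>\<^sup>+x. indicator ?A (T y + x - T y) * indicator B (T y + x) \<partial>lborel)"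
      by (rule nn_integral_lborel_translate[symmetric,
            where f="\<lambda>x. indicator ?A (x - T y) * indicator B x"]) measurable
    then show "(\<integral>\<^sup>+x. ?I x y \<partial>lborel) = (\<integral>\<^sup>+x. indicator ?A (x - T y) * indicator B x \<partial>lborel)"
      by simp
  qed
  also have "\<dots> = (\<integral>\<^sup>+x. \<integral>\<^sup>+y. indicator ?A (x - T y) * indicator B x \<partial>lborel \<partial>lborel)"
    by (rule lborel_pair.Fubini'[symmetric]) measurable
  also have "\<dots> = emeasure lborel ?A * emeasure lborel B"
    by (simp add: nn_integral_multc ball nn_integral_cmult)
  finally have eq: "emeasure lborel ?A * emeasure (distr lborel borel T) B
      = emeasure lborel ?A * emeasure lborel B" .
  have "emeasure lborel ?A \<noteq> 0" "emeasure lborel ?A \<noteq> \<infinity>"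
    using content_ball_pos[of 1 "0::'a"] emeasure_lborel_ball_finite[of "0::'a" 1]
    by (auto simp: measure_def)
  with eq show "emeasure (distr lborel borel T) B = emeasure lborel B"
    by (simp add: ennreal_mult_cancel_left)
qed simp

text \<open>Two isometries are glued: one from \<open>S\<close> onto \<open>T\<close> and one
  between the orthogonal complements, which also have equal dimension. The images of the two
  components are orthogonal, so Pythagoras shows that the sum preserves norms.\<close>

lemma orthogonal_transformation_subspace_exists:
  fixes S T :: "'a::euclidean_space set"
  assumes S: "subspace S" and T: "subspace T" and dim: "dim S = dim T"
  obtains f where "orthogonal_transformation f" "f ` S = T"
proof -
  let ?S = "{y. \<forall>x\<in>S. orthogonal x y}" and ?T = "{y. \<forall>x\<in>T. orthogonal x y}"
  have subS: "subspace ?S" and subT: "subspace ?T"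
    by (simp_all add: subspace_orthogonal_to_vectors)
  have "dim ?S + dim S = dim ?T + dim T"
    using dim_subspace_orthogonal_to_vectors[OF S subspace_UNIV]
      dim_subspace_orthogonal_to_vectors[OF T subspace_UNIV] by simp
  then have dim': "dim ?S = dim ?T" using dim by simp
  obtain f where f: "linear f" "f ` S = T" "\<And>x. x \<in> S \<Longrightarrow> norm (f x) = norm x"
    by (rule isometries_subspaces[OF S T dim]) blast
  obtain g where g: "linear g" "g ` ?S = ?T" "\<And>x. x \<in> ?S \<Longrightarrow> norm (g x) = norm x"
    by (rule isometries_subspaces[OF subS subT dim']) blast
  obtain B where B: "B \<subseteq> S" "pairwise orthogonal B" "\<And>x. x \<in> B \<Longrightarrow> norm x = 1"
      "independent B" "span B = S"
    by (rule orthonormal_basis_subspace[OF S]) blast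
  then have finB: "finite B" by (simp add: independent_imp_finite)
  define p where "p x = (\<Sum>b\<in>B. (x \<bullet> b) *\<^sub>R b)" for x
  have linp: "linear p"
    unfolding p_def
    by (rule linearI) (simp_all add: inner_add_left scaleR_add_left sum.distrib scaleR_sum_right)
  have pS: "p x \<in> S" for x
    unfolding p_def using B(1) S by (meson subsetD subspace_mul subspace_sum)
  have pid: "p x = x" if "x \<in> S" for x
    unfolding p_def using B finB that by (intro orthonormal_basis_expand) auto
  have qS: "x - p x \<in> ?S" for x
  proof -
    have "orthogonal (x - p x) b" if "b \<in> B" for b
    proof -
      have "p x \<bullet> b = (\<Sum>c\<in>B. if c = b then x \<bullet> b else 0)"
        unfolding p_def inner_sum_left
      proof (rule sum.cong)
        fix c assume "c \<in> B"
        show "(x \<bullet> c) *\<^sub>R c \<bullet> b = (if c = b then x \<bullet> b else 0)"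
          using B(2,3) \<open>c \<in> B\<close> that
          by (auto simp: pairwise_def orthogonal_def norm_eq_1)
      qed simp
      then show ?thesis using finB that by (simp add: orthogonal_def inner_diff_left)
    qed
    then have "orthogonal (x - p x) y" if "y \<in> span B" for y
      using that by (rule orthogonal_to_span[rotated])
    then show ?thesis using B(5) by (simp add: orthogonal_commute)
  qed
  define h where "h x = f (p x) + g (x - p x)" for x
  have "linear h"
    unfolding h_def
    by (rule linearI)
      (simp_all add: linear_add[OF linp] linear_cmul[OF linp] linear_add[OF f(1)] linear_cmul[OF f(1)]
        linear_add[OF g(1)] linear_cmul[OF g(1)] linear_diff[OF g(1)] algebra_simps)
  moreover have "norm (h x) = norm x" for x
  proof -
    have "orthogonal (f (p x)) (g (x - p x))"
      using f(2) g(2) pS[of x] qS[of x] by blast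
    then have "(norm (h x))\<^sup>2 = (norm (f (p x)))\<^sup>2 + (norm (g (x - p x)))\<^sup>2"
      unfolding h_def by (rule norm_add_Pythagorean)
    also have "\<dots> = (norm (p x))\<^sup>2 + (norm (x - p x))\<^sup>2"
      using f(3)[OF pS] g(3)[OF qS] by simp
    also have "\<dots> = (norm (p x + (x - p x)))\<^sup>2"
      using pS[of x] qS[of x] by (intro norm_add_Pythagorean[symmetric]) blast
    finally show ?thesis by simp
  qed
  ultimately have "orthogonal_transformation h"
    by (simp add: orthogonal_transformation)
  moreover have "h ` S = T"
    using f(2) by (auto simp: h_def pid linear_0[OF g(1)] image_iff)
  ultimately show thesis by (rule that)
qed

section \<open>The uniform distribution on the sphere\<close>

lemma emeasure_lborel_ball_bounds:
  "emeasure lborel (ball (0::'a::euclidean_space) 1) \<noteq> 0"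
  "emeasure lborel (ball (0::'a::euclidean_space) 1) \<noteq> \<infinity>"
  using content_ball_pos[of 1 "0::'a"] emeasure_lborel_ball_finite[of "0::'a" 1]
  by (auto simp: measure_def)

lemma space_unif_sphere [simp]: "space (unif_sphere :: (real^'n) measure) = UNIV"
  and sets_unif_sphere [simp, measurable_cong]: "sets (unif_sphere :: (real^'n) measure) = sets borel"
  by (simp_all add: unif_sphere_def)

lemma emeasure_unif_sphere:
  fixes A :: "(real^'n) set"
  assumes [measurable]: "A \<in> sets borel"
  shows "emeasure unif_sphere A
    = emeasure lborel (ball 0 1 \<inter> {x. x /\<^sub>R norm x \<in> A}) / emeasure lborel (ball (0::real^'n) 1)"
proof -
  have eq: "(\<lambda>x. x /\<^sub>R norm x) -` A = {x::real^'n. x /\<^sub>R norm x \<in> A}" by auto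
  have [measurable]: "{x::real^'n. x /\<^sub>R norm x \<in> A} \<in> sets borel"
    using measurable_sets_borel[of "\<lambda>x. x /\<^sub>R norm x" borel A] by (simp add: eq)
  show ?thesis
    unfolding unif_sphere_def by (simp add: emeasure_distr eq)
qed

lemma prob_space_unif_sphere: "prob_space (unif_sphere :: (real^'n) measure)"
proof
  show "emeasure (unif_sphere :: (real^'n) measure) (space unif_sphere) = 1"
    using emeasure_lborel_ball_bounds[where 'a="real^'n"]
    by (simp add: emeasure_unif_sphere ennreal_divide_self top.not_eq_extremum)
qed

text \<open>An orthogonal map preserves the unit ball and commutes with normalization, so the claim
  reduces to the invariance of Lebesgue measure.\<close>

lemma unif_sphere_distr_orthogonal_transformation:
  fixes T :: "real^'n \<Rightarrow> real^'n"
  assumes T: "orthogonal_transformation T"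
  shows "distr unif_sphere borel T = unif_sphere"
proof (rule measure_eqI)
  note [measurable] = borel_measurable_orthogonal_transformation[OF T]
  fix B assume "B \<in> sets (distr unif_sphere borel T)"
  then have [measurable]: "B \<in> sets borel" by simp
  have "ball 0 1 \<inter> {x. x /\<^sub>R norm x \<in> T -` B} = T -` (ball 0 1 \<inter> {x. x /\<^sub>R norm x \<in> B})"
    by (auto simp: orthogonal_transformation_norm[OF T] orthogonal_transformation_scaleR[OF T])
  moreover have "{x::real^'n. x /\<^sub>R norm x \<in> B} \<in> sets borel"
    using measurable_sets_borel[of "\<lambda>x. x /\<^sub>R norm x" borel B] by (simp add: vimage_def)
  moreover have "T -` B \<in> sets borel"
    using measurable_sets_borel[of T borel B] by simp
  ultimately show "emeasure (distr unif_sphere borel T) B = emeasure unif_sphere B"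
    using emeasure_distr[of T lborel borel "ball 0 1 \<inter> {x. x /\<^sub>R norm x \<in> B}"]
    by (simp add: emeasure_distr emeasure_unif_sphere lborel_distr_orthogonal_transformation[OF T])
qed simp

text \<open>Points of the ball whose normalization lies in \<open>V\<close> lie in \<open>V\<close>
  themselves, and a proper subspace is a Lebesgue null set.\<close>

lemma emeasure_unif_sphere_subspace:
  fixes V :: "(real^'n) set"
  assumes V: "subspace V" and "dim V < CARD('n)"
  shows "emeasure unif_sphere V = 0"
proof -
  have meas: "V \<in> sets borel" using closed_subspace[OF V] by simp
  have "negligible V" using assms by (intro negligible_lowdim) simp
  then have null: "emeasure lborel V = 0"
    using meas by (simp add: negligible_iff_null_sets null_sets_completion_iff null_setsD1)
  have sub: "ball 0 1 \<inter> {x. x /\<^sub>R norm x \<in> V} \<subseteq> V"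
  proof
    fix x assume "x \<in> ball 0 1 \<inter> {x. x /\<^sub>R norm x \<in> V}"
    then have "x /\<^sub>R norm x \<in> V" by simp
    from subspace_mul[OF V this, of "norm x"] have "norm x *\<^sub>R (x /\<^sub>R norm x) \<in> V" .
    \<comment> \<open>The origin normalizes to 0, since \<open>inverse 0 = 0\<close>, and needs its
      own case.\<close>
    then show "x \<in> V" using subspace_0[OF V] by (cases "x = 0") auto
  qed
  have "emeasure lborel (ball 0 1 \<inter> {x. x /\<^sub>R norm x \<in> V}) = 0"
    by (rule emeasure_eq_0[OF _ null sub]) (simp add: meas)
  then show ?thesis by (simp add: emeasure_unif_sphere meas)
qed

section \<open>Volume comparison by diagonal maps\<close>

lemma emeasure_lborel_diagonal_preimage:
  fixes c :: "'a::euclidean_space \<Rightarrow> real"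
  assumes c: "\<And>j. j \<in> Basis \<Longrightarrow> c j > 0" and [measurable]: "A \<in> sets borel"
  shows "emeasure lborel A
    = ennreal (\<Prod>j\<in>Basis. c j) * emeasure lborel ((\<lambda>x. \<Sum>j\<in>Basis. (c j * (x \<bullet> j)) *\<^sub>R j) -` A)"
proof -
  have "lborel = density (distr lborel borel (\<lambda>x. 0 + (\<Sum>j\<in>Basis. (c j * (x \<bullet> j)) *\<^sub>R j)))
      (\<lambda>_. (\<Prod>j\<in>Basis. \<bar>c j\<bar>))"
    using c by (intro lborel_affine_euclidean) force
  moreover have "(\<Prod>j\<in>Basis. \<bar>c j\<bar>) = (\<Prod>j\<in>Basis. c j)"
    using c by (intro prod.cong) (auto simp: less_imp_le)
  ultimately have "emeasure lborel A = emeasure (density (distr lborel borel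
      (\<lambda>x. \<Sum>j\<in>Basis. (c j * (x \<bullet> j)) *\<^sub>R j)) (\<lambda>_. ennreal (\<Prod>j\<in>Basis. c j))) A"
    by simp
  then show ?thesis
    by (simp add: emeasure_density nn_integral_cmult emeasure_distr)
qed

text \<open>The diagonal map with entries \<open>s\<close> on \<open>I\<close> and \<open>t\<close> off \<open>I\<close> maps \<open>A\<close> into the unit ball,
  so comparing volumes bounds the volume of \<open>A\<close>.\<close>

lemma emeasure_lborel_cone_le:
  fixes I A :: "'a::euclidean_space set"
  assumes I: "I \<subseteq> Basis" and s: "s > 0" and t: "t > 0" and A: "A \<in> sets borel" "A \<subseteq> ball 0 1"
    and le: "\<And>x. x \<in> A \<Longrightarrow>
      s\<^sup>2 * (\<Sum>i\<in>I. (x \<bullet> i)\<^sup>2) + t\<^sup>2 * ((norm x)\<^sup>2 - (\<Sum>i\<in>I. (x \<bullet> i)\<^sup>2)) \<le> (norm x)\<^sup>2"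
  shows "ennreal (s ^ card I * t ^ (DIM('a) - card I)) * emeasure lborel A
    \<le> emeasure lborel (ball (0::'a) 1)"
proof -
  define c where "c j = (if j \<in> I then s else t)" for j
  define T where "T x = (\<Sum>j\<in>Basis. (c j * (x \<bullet> j)) *\<^sub>R j)" for x
  have finI: "finite I" by (rule finite_subset[OF I finite_Basis])
  have T_inner: "T x \<bullet> j = c j * (x \<bullet> j)" if "j \<in> Basis" for x j
    unfolding T_def using that by simp
  have split: "(\<Sum>j\<in>Basis. h j) = (\<Sum>j\<in>I. h j) + (\<Sum>j\<in>Basis - I. h j)" for h :: "'a \<Rightarrow> real"
    by (subst sum.subset_diff[OF I]) simp_all
  have norm_split: "(norm x)\<^sup>2 = (\<Sum>j\<in>Basis. (x \<bullet> j)\<^sup>2)" for x :: 'a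
    by (simp add: norm_eq_sqrt_inner euclidean_inner[of x x] power2_eq_square sum_nonneg)
  have normT: "(norm (T x))\<^sup>2
      = s\<^sup>2 * (\<Sum>i\<in>I. (x \<bullet> i)\<^sup>2) + t\<^sup>2 * ((norm x)\<^sup>2 - (\<Sum>i\<in>I. (x \<bullet> i)\<^sup>2))" for x
  proof -
    have "(norm (T x))\<^sup>2 = (\<Sum>j\<in>Basis. (c j)\<^sup>2 * (x \<bullet> j)\<^sup>2)"
      by (simp add: norm_split T_inner power_mult_distrib)
    also have "\<dots> = (\<Sum>j\<in>I. s\<^sup>2 * (x \<bullet> j)\<^sup>2) + (\<Sum>j\<in>Basis - I. t\<^sup>2 * (x \<bullet> j)\<^sup>2)"
      by (simp add: split c_def)
    also have "\<dots> = s\<^sup>2 * (\<Sum>i\<in>I. (x \<bullet> i)\<^sup>2) + t\<^sup>2 * (\<Sum>i\<in>Basis - I. (x \<bullet> i)\<^sup>2)"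
      by (simp add: sum_distrib_left)
    finally show ?thesis by (simp add: norm_split[of x] split)
  qed
  have "A \<subseteq> T -` ball 0 1"
  proof
    fix x assume x: "x \<in> A"
    then have "(norm (T x))\<^sup>2 \<le> (norm x)\<^sup>2" using le normT by simp
    then have "norm (T x) \<le> norm x" by (rule power2_le_imp_le) simp
    also have "\<dots> < 1" using A(2) x by auto
    finally show "x \<in> T -` ball 0 1" by simp
  qed
  moreover have "T -` ball 0 1 \<in> sets borel"
  proof -
    have "T \<in> borel_measurable borel" unfolding T_def by measurable
    from measurable_sets_borel[OF this, of "ball 0 1"] show ?thesis by simp
  qed
  ultimately have mono: "emeasure lborel A \<le> emeasure lborel (T -` ball 0 1)"
    by (intro emeasure_mono) simp_all
  have "(\<Prod>j\<in>Basis. c j) = (\<Prod>j\<in>Basis - I. c j) * (\<Prod>j\<in>I. c j)"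
    by (rule prod.subset_diff[OF I]) simp
  also have "\<dots> = s ^ card I * t ^ (DIM('a) - card I)"
    using I finI by (simp add: c_def card_Diff_subset)
  finally have prod: "(\<Prod>j\<in>Basis. c j) = s ^ card I * t ^ (DIM('a) - card I)" .
  have "emeasure lborel (ball (0::'a) 1)
      = ennreal (\<Prod>j\<in>Basis. c j) * emeasure lborel (T -` ball 0 1)"
    unfolding T_def by (rule emeasure_lborel_diagonal_preimage) (auto simp: c_def s t)
  then show ?thesis
    using mult_left_mono[OF mono, of "ennreal (\<Prod>j\<in>Basis. c j)"] prod by simp
qed

section \<open>Projection of a random direction to a fixed subspace\<close>

text \<open>For a subspace \<open>S\<close> and \<open>a \<ge> 0\<close> this says that the orthogonal projection of \<open>u\<close> to \<open>S\<close> is longer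
  than \<open>a * norm u\<close>; the existential form makes measurability in a spanning family of \<open>S\<close> accessible.\<close>

definition aligned :: "real \<Rightarrow> 'a::real_inner \<Rightarrow> 'a set \<Rightarrow> bool" where
  "aligned a u S \<longleftrightarrow> (\<exists>w\<in>S. u \<bullet> w > a * norm u * norm w)"

lemma aligned_scaleR:
  assumes "c > 0"
  shows "aligned a (c *\<^sub>R u) S \<longleftrightarrow> aligned a u S"
proof -
  have "a * norm (c *\<^sub>R u) * norm w < c *\<^sub>R u \<bullet> w \<longleftrightarrow> a * norm u * norm w < u \<bullet> w" for w
  proof -
    have "a * norm (c *\<^sub>R u) * norm w = c * (a * norm u * norm w)"
      using assms by simp
    then show ?thesis using assms by (simp add: mult.assoc)
  qed
  then show ?thesis by (simp add: aligned_def)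
qed

lemma aligned_normalize: "aligned a (x /\<^sub>R norm x) S \<longleftrightarrow> aligned a x S"
  using aligned_scaleR[of "inverse (norm x)"] by (cases "x = 0") auto

lemma aligned_orthogonal_transformation:
  assumes "orthogonal_transformation T"
  shows "aligned a (T u) (T ` S) \<longleftrightarrow> aligned a u S"
  using assms by (simp add: aligned_def orthogonal_transformation_norm orthogonal_transformation_def)

text \<open>Cauchy-Schwarz. It settles the upper tail for thresholds no projection can exceed, and
  with \<open>a = 1\<close> it bounds the unrestricted perturbation from below.\<close>

lemma not_aligned_ge_1:
  assumes "a \<ge> 1"
  shows "\<not> aligned a u S"
proof -
  have "u \<bullet> w \<le> a * norm u * norm w" for w
  proof -
    have "u \<bullet> w \<le> norm u * norm w" by (rule norm_cauchy_schwarz)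
    also have "\<dots> \<le> a * (norm u * norm w)"
      using mult_right_mono[OF assms, of "norm u * norm w"] by simp
    finally show ?thesis by (simp add: mult.assoc)
  qed
  then show ?thesis by (simp add: aligned_def not_less)
qed

lemma open_aligned: "open {u. aligned a u S}"
proof -
  have "{u. aligned a u S} = (\<Union>w\<in>S. {u. a * norm u * norm w < u \<bullet> w})"
    by (auto simp: aligned_def)
  moreover have "open {u. a * norm u * norm w < u \<bullet> w}" for w
    by (intro open_Collect_less continuous_intros)
  ultimately show ?thesis by auto
qed

text \<open>On \<open>span I\<close> the functional \<open>u \<bullet> w\<close> equals
  \<open>p \<bullet> w\<close> for the orthogonal projection \<open>p\<close> of \<open>u\<close>.
  By Cauchy-Schwarz its ratio to \<open>norm w\<close> is at most \<open>norm p\<close>, with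
  \<open>w = p\<close> as the optimal witness when \<open>p\<close> is nonzero. Alignment is thus
  \<open>a * norm u < norm p\<close>, which is then squared.\<close>

lemma aligned_coordinate_subspace_iff:
  fixes I :: "'a::euclidean_space set"
  assumes I: "I \<subseteq> Basis" and a: "a \<ge> 0"
  shows "aligned a u (span I) \<longleftrightarrow> a\<^sup>2 * (norm u)\<^sup>2 < (\<Sum>i\<in>I. (u \<bullet> i)\<^sup>2)"
proof -
  have finI: "finite I" by (rule finite_subset[OF I finite_Basis])
  define p where "p = (\<Sum>i\<in>I. (u \<bullet> i) *\<^sub>R i)"
  have pS: "p \<in> span I" unfolding p_def by (intro span_sum span_mul span_base)
  have p_inner: "p \<bullet> i = u \<bullet> i" if "i \<in> I" for i
  proof -
    have "p \<bullet> i = (\<Sum>j\<in>I. if j = i then u \<bullet> i else 0)"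
      unfolding p_def inner_sum_left
      using I that by (intro sum.cong) (auto simp: inner_Basis subset_iff)
    then show ?thesis using that finI by simp
  qed
  have inner_eq: "u \<bullet> w = p \<bullet> w" if "w \<in> span I" for w
    using that
  proof (induction rule: span_induct_alt)
    case (step c x y) then show ?case by (simp add: inner_add_right p_inner)
  qed simp
  have up: "u \<bullet> p = (\<Sum>i\<in>I. (u \<bullet> i)\<^sup>2)"
    by (simp add: p_def inner_sum_right power2_eq_square)
  have np: "(norm p)\<^sup>2 = (\<Sum>i\<in>I. (u \<bullet> i)\<^sup>2)"
    using inner_eq[OF pS] up by (simp add: power2_norm_eq_inner)
  have "aligned a u (span I) \<longleftrightarrow> a * norm u < norm p"
  proof
    assume "aligned a u (span I)"
    then obtain w where w: "w \<in> span I" "a * norm u * norm w < u \<bullet> w"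
      by (auto simp: aligned_def)
    have "u \<bullet> w \<le> norm p * norm w"
      using inner_eq[OF w(1)] norm_cauchy_schwarz[of p w] by simp
    with w(2) have "a * norm u * norm w < norm p * norm w" by simp
    then show "a * norm u < norm p" by (simp add: mult_less_cancel_right)
  next
    assume less: "a * norm u < norm p"
    moreover have "0 \<le> a * norm u" using a by simp
    ultimately have "norm p > 0" by linarith
    then have "a * norm u * norm p < norm p * norm p" using less by simp
    also have "\<dots> = u \<bullet> p" using up np by (simp add: power2_eq_square)
    finally show "aligned a u (span I)" using pS by (auto simp: aligned_def)
  qed
  also have "\<dots> \<longleftrightarrow> (a * norm u)\<^sup>2 < (norm p)\<^sup>2"
    using a by (metis abs_le_square_iff abs_of_nonneg mult_nonneg_nonneg norm_ge_zero not_le)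
  finally show ?thesis by (simp add: np power_mult_distrib)
qed

text \<open>Invariance of \<open>Q\<close> under normalization makes the spherical probability the
  fraction of the unit ball on which \<open>Q\<close> holds, and this fraction is bounded by the
  reciprocal determinant of the diagonal map.\<close>

lemma emeasure_unif_sphere_cone_le:
  fixes I :: "(real^'n) set"
  assumes I: "I \<subseteq> Basis" and s: "s > 0" and t: "t > 0"
    and A: "{x. Q x} \<in> sets borel" and Q: "\<And>x. Q (x /\<^sub>R norm x) \<longleftrightarrow> Q x"
    and le: "\<And>x. Q x \<Longrightarrow>
      s\<^sup>2 * (\<Sum>i\<in>I. (x \<bullet> i)\<^sup>2) + t\<^sup>2 * ((norm x)\<^sup>2 - (\<Sum>i\<in>I. (x \<bullet> i)\<^sup>2)) \<le> (norm x)\<^sup>2"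
  shows "emeasure unif_sphere {x. Q x} \<le> ennreal (1 / (s ^ card I * t ^ (CARD('n) - card I)))"
proof -
  let ?B = "ball (0::real^'n) 1" and ?k = "s ^ card I * t ^ (CARD('n) - card I)"
  have "?B \<inter> {x. x /\<^sub>R norm x \<in> {x. Q x}} = ?B \<inter> {x. Q x}" using Q by simp
  then have eq: "emeasure unif_sphere {x. Q x} = emeasure lborel (?B \<inter> {x. Q x}) / emeasure lborel ?B"
    using emeasure_unif_sphere[OF A] by simp
  have "ennreal ?k * emeasure lborel (?B \<inter> {x. Q x}) \<le> emeasure lborel ?B"
    using emeasure_lborel_cone_le[OF I s t, of "?B \<inter> {x. Q x}"] A le by auto
  then have "ennreal (1 / ?k) * (ennreal ?k * emeasure lborel (?B \<inter> {x. Q x}))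
      \<le> ennreal (1 / ?k) * emeasure lborel ?B"
    by (rule mult_left_mono) simp
  moreover have "ennreal (1 / ?k) * ennreal ?k = 1"
    using s t by (simp add: ennreal_mult[symmetric])
  ultimately have "emeasure lborel (?B \<inter> {x. Q x}) \<le> ennreal (1 / ?k) * emeasure lborel ?B"
    by (simp add: mult.assoc[symmetric])
  then have "emeasure lborel (?B \<inter> {x. Q x}) / emeasure lborel ?B
      \<le> ennreal (1 / ?k) * emeasure lborel ?B / emeasure lborel ?B"
    by (rule divide_right_mono_ennreal)
  also have "\<dots> = ennreal (1 / ?k)"
    using emeasure_lborel_ball_bounds[where 'a="real^'n"]
    by (simp add: ennreal_times_divide[symmetric] ennreal_divide_self top.not_eq_extremum)
  finally show ?thesis by (simp add: eq)
qed

text \<open>The first factor contributes exactly \<open>exp (m / 2 * ln \<beta>)\<close>. The second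
  is \<open>sqrt (1 + y) ^ (d - m)\<close> with \<open>y = (1 - \<beta>) * m / (d - m)\<close>, and
  \<open>1 + y \<le> exp y\<close> removes the dependence on \<open>d\<close>.\<close>

lemma volume_ratio_le_exp:
  fixes m d :: nat and \<beta> :: real
  assumes "m < d" and \<beta>: "\<beta> > 0" and \<beta>d: "\<beta> * m < d"
  shows "1 / (sqrt (1 / \<beta>) ^ m * sqrt ((real d - real m) / (real d - \<beta> * real m)) ^ (d - m))
    \<le> exp (real m / 2 * (1 - \<beta> + ln \<beta>))"
proof -
  define n where "n = d - m"
  have n: "real n = real d - real m" "n > 0" using assms by (auto simp: n_def)
  define y where "y = (1 - \<beta>) * real m / real n"
  have y: "(real d - \<beta> * real m) / (real d - real m) = 1 + y"
    using n by (simp add: y_def field_simps)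
  have "sqrt (1 + y) \<le> exp (y / 2)"
  proof -
    have "sqrt (1 + y) \<le> sqrt (exp y)" using exp_ge_add_one_self[of y] by simp
    also have "\<dots> = sqrt ((exp (y / 2))\<^sup>2)" by (simp add: exp_double[symmetric])
    finally show ?thesis by simp
  qed
  moreover have pos: "1 + y > 0" using y \<beta>d n by (metis diff_gt_0_iff_gt divide_pos_pos of_nat_0_less_iff)
  ultimately have "sqrt (1 + y) ^ n \<le> exp (y / 2) ^ n" by (intro power_mono) auto
  also have "\<dots> = exp ((1 - \<beta>) * real m / 2)"
    using n(2) by (simp add: exp_of_nat_mult[symmetric] y_def)
  finally have 1: "sqrt (1 + y) ^ n \<le> exp ((1 - \<beta>) * real m / 2)" .
  have "sqrt \<beta> = exp (ln \<beta> / 2)"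
    using \<beta> by (simp add: ln_sqrt[symmetric])
  then have 2: "sqrt \<beta> ^ m = exp (real m * (ln \<beta> / 2))" by (simp only: exp_of_nat_mult)
  have "(real d - real m) / (real d - \<beta> * real m) = 1 / (1 + y)"
    unfolding y[symmetric] by simp
  then have "1 / (sqrt (1 / \<beta>) ^ m * sqrt ((real d - real m) / (real d - \<beta> * real m)) ^ (d - m))
      = sqrt \<beta> ^ m * sqrt (1 + y) ^ n"
    by (simp add: real_sqrt_divide power_divide n_def)
  also have "\<dots> \<le> exp (real m * (ln \<beta> / 2)) * exp ((1 - \<beta>) * real m / 2)"
    unfolding 2 using 1 by simp
  also have "\<dots> = exp (real m / 2 * (1 - \<beta> + ln \<beta>))"
    by (simp add: exp_add[symmetric] algebra_simps add_divide_distrib diff_divide_distrib)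
  finally show ?thesis .
qed

lemma obtain_coordinate_rotation:
  fixes V :: "(real^'n) set"
  assumes V: "subspace V"
  obtains I :: "(real^'n) set" and T where "I \<subseteq> Basis" "card I = dim V" "orthogonal_transformation T" "T ` V = span I"
proof -
  have "dim V \<le> card (Basis :: (real^'n) set)" using dim_subset_UNIV[of V] by simp
  then obtain I where I: "I \<subseteq> (Basis :: (real^'n) set)" "card I = dim V"
    by (metis obtain_subset_with_card_n)
  have "independent I" by (rule independent_mono[OF independent_Basis I(1)])
  then have "dim (span I) = dim V" using I(2) by (simp add: dim_eq_card_independent)
  then have "dim V = dim (span I)" by simp
  then obtain T where "orthogonal_transformation T" "T ` V = span I"
    by (rule orthogonal_transformation_subspace_exists[OF V subspace_span])
  with I show thesis by (rule that)
qed

lemma emeasure_unif_sphere_aligned_rotate: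
  fixes V :: "(real^'n) set" and T :: "real^'n \<Rightarrow> real^'n"
  assumes T: "orthogonal_transformation T"
  shows "emeasure unif_sphere {u. aligned a u V} = emeasure unif_sphere {u. aligned a u (T ` V)}"
    and "emeasure unif_sphere {u. \<not> aligned a u V} = emeasure unif_sphere {u. \<not> aligned a u (T ` V)}"
proof -
  have [measurable]: "T \<in> borel_measurable borel"
    by (rule borel_measurable_orthogonal_transformation[OF T])
  have open': "{u. aligned a u (T ` V)} \<in> sets borel" using open_aligned by (rule borel_open)
  have closed': "{u. \<not> aligned a u (T ` V)} \<in> sets borel"
    using open' by (simp add: Collect_neg_eq borel_comp)
  have "emeasure (distr unif_sphere borel T) {u. aligned a u (T ` V)}
      = emeasure unif_sphere {u. aligned a u V}"
    using open' by (subst emeasure_distr) (auto simp: vimage_def aligned_orthogonal_transformation[OF T])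
  then show "emeasure unif_sphere {u. aligned a u V} = emeasure unif_sphere {u. aligned a u (T ` V)}"
    by (simp add: unif_sphere_distr_orthogonal_transformation[OF T])
  have "emeasure (distr unif_sphere borel T) {u. \<not> aligned a u (T ` V)}
      = emeasure unif_sphere {u. \<not> aligned a u V}"
    using closed' by (subst emeasure_distr) (auto simp: vimage_def aligned_orthogonal_transformation[OF T])
  then show "emeasure unif_sphere {u. \<not> aligned a u V} = emeasure unif_sphere {u. \<not> aligned a u (T ` V)}"
    by (simp add: unif_sphere_distr_orthogonal_transformation[OF T])
qed

text \<open>After a rotation \<open>V\<close> is a coordinate subspace. One pair \<open>s\<close>,
  \<open>t\<close> serves both tails: the sign of \<open>s\<^sup>2 - t\<^sup>2\<close> is that of
  \<open>1 - \<beta>\<close>, so the diagonal map shrinks norms on the non-aligned cone if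
  \<open>\<beta> \<le> 1\<close> and on the aligned cone if \<open>\<beta> \<ge> 1\<close>.\<close>

lemma
  fixes V :: "(real^'n) set" and \<beta> :: real
  defines "a \<equiv> sqrt (\<beta> * real (dim V) / real CARD('n))"
    and "bound \<equiv> ennreal (exp (real (dim V) / 2 * (1 - \<beta> + ln \<beta>)))"
  assumes V: "subspace V" and dim: "dim V < CARD('n)" and \<beta>: "\<beta> > 0" "\<beta> * dim V < CARD('n)"
  shows unif_sphere_lower_tail: "\<beta> \<le> 1 \<Longrightarrow> emeasure unif_sphere {u. \<not> aligned a u V} \<le> bound"
    and unif_sphere_upper_tail: "\<beta> \<ge> 1 \<Longrightarrow> emeasure unif_sphere {u. aligned a u V} \<le> bound"
proof -
  obtain I :: "(real^'n) set" and T where I: "I \<subseteq> Basis" "card I = dim V" and T: "orthogonal_transformation T" "T ` V = span I"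
    by (rule obtain_coordinate_rotation[OF V])
  define m d where "m = real (dim V)" and "d = real CARD('n)"
  \<comment> \<open>These values maximize \<open>s\<^sup>2 ^ m * t\<^sup>2 ^ (d - m)\<close> under
    the constraint \<open>a\<^sup>2 * s\<^sup>2 + (1 - a\<^sup>2) * t\<^sup>2 = 1\<close>, which
    says that norms are preserved on the boundary of the cone; at the optimum the two summands are
    \<open>m / d\<close> and \<open>1 - m / d\<close>.\<close>
  define s t where "s = sqrt (1 / \<beta>)" and "t = sqrt ((d - m) / (d - \<beta> * m))"
  have d: "d > 0" "m < d" "\<beta> * m < d" "m \<ge> 0" using dim \<beta> by (auto simp: m_def d_def)
  have s: "s > 0" "s\<^sup>2 = 1 / \<beta>" and t: "t > 0" "t\<^sup>2 = (d - m) / (d - \<beta> * m)"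
    using \<beta>(1) d by (auto simp: s_def t_def)
  have a: "a \<ge> 0" "a\<^sup>2 = \<beta> * m / d" using \<beta>(1) d by (auto simp: a_def m_def d_def)
  have one: "a\<^sup>2 * s\<^sup>2 + (1 - a\<^sup>2) * t\<^sup>2 = 1"
  proof -
    have "1 - a\<^sup>2 = (d - \<beta> * m) / d" using d by (simp add: a field_simps)
    then have "(1 - a\<^sup>2) * t\<^sup>2 = (d - m) / d" unfolding t(2) using d by simp
    also have "\<dots> = 1 - m / d" using d by (simp add: diff_divide_distrib)
    finally have "(1 - a\<^sup>2) * t\<^sup>2 = 1 - m / d" .
    moreover have "a\<^sup>2 * s\<^sup>2 = m / d" using \<beta>(1) by (simp add: a s)
    ultimately show ?thesis by simp
  qed
  \<comment> \<open>Here \<open>P\<close> stands for the squared length of the projection and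
    \<open>N\<close> for the squared norm. By \<open>one\<close>, the left side exceeds
    \<open>N\<close> by exactly
    \<open>(s\<^sup>2 - t\<^sup>2) * (P - a\<^sup>2 * N)\<close>.\<close>
  have key: "s\<^sup>2 * P + t\<^sup>2 * (N - P) \<le> N" if "(s\<^sup>2 - t\<^sup>2) * (P - a\<^sup>2 * N) \<le> 0" for P N
  proof -
    have "s\<^sup>2 * P + t\<^sup>2 * (N - P) = (s\<^sup>2 - t\<^sup>2) * (P - a\<^sup>2 * N) + (a\<^sup>2 * s\<^sup>2 + (1 - a\<^sup>2) * t\<^sup>2) * N"
      by (simp add: algebra_simps)
    then show ?thesis using that one by simp
  qed
  have bound: "ennreal (1 / (s ^ card I * t ^ (CARD('n) - card I))) \<le> bound"
    unfolding bound_def s_def t_def m_def d_def I(2)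
    by (intro ennreal_leI volume_ratio_le_exp dim \<beta>)
  have st: "s\<^sup>2 - t\<^sup>2 = d * (1 - \<beta>) / (\<beta> * (d - \<beta> * m))"
    unfolding s t using d \<beta>(1) by (subst diff_frac_eq) (simp_all add: algebra_simps)
  have den: "\<beta> * (d - \<beta> * m) > 0" using d \<beta>(1) by simp
  note al = aligned_coordinate_subspace_iff[OF I(1) a(1)]
  have meas: "{u. aligned a u (span I)} \<in> sets borel" using open_aligned by (rule borel_open)
  {
    assume "\<beta> \<le> 1"
    then have "s\<^sup>2 - t\<^sup>2 \<ge> 0" unfolding st using den d by (intro divide_nonneg_pos mult_nonneg_nonneg) auto
    have "emeasure unif_sphere {u. \<not> aligned a u (span I)}
        \<le> ennreal (1 / (s ^ card I * t ^ (CARD('n) - card I)))"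
    proof (rule emeasure_unif_sphere_cone_le[OF I(1) s(1) t(1)])
      show "{x. \<not> aligned a x (span I)} \<in> sets borel"
        using meas by (simp add: Collect_neg_eq borel_comp)
      fix x assume "\<not> aligned a x (span I)"
      then show "s\<^sup>2 * (\<Sum>i\<in>I. (x \<bullet> i)\<^sup>2) + t\<^sup>2 * ((norm x)\<^sup>2 - (\<Sum>i\<in>I. (x \<bullet> i)\<^sup>2)) \<le> (norm x)\<^sup>2"
        using \<open>s\<^sup>2 - t\<^sup>2 \<ge> 0\<close> by (intro key mult_nonneg_nonpos) (simp_all add: al)
    qed (simp add: aligned_normalize)
    then show "emeasure unif_sphere {u. \<not> aligned a u V} \<le> bound"
      using bound by (simp add: emeasure_unif_sphere_aligned_rotate[OF T(1), of a V] T(2))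
  next
    assume "\<beta> \<ge> 1"
    then have "s\<^sup>2 - t\<^sup>2 \<le> 0" unfolding st using den d
      by (intro divide_nonpos_pos mult_nonneg_nonpos) auto
    have "emeasure unif_sphere {u. aligned a u (span I)}
        \<le> ennreal (1 / (s ^ card I * t ^ (CARD('n) - card I)))"
    proof (rule emeasure_unif_sphere_cone_le[OF I(1) s(1) t(1) meas])
      fix x assume "aligned a x (span I)"
      then show "s\<^sup>2 * (\<Sum>i\<in>I. (x \<bullet> i)\<^sup>2) + t\<^sup>2 * ((norm x)\<^sup>2 - (\<Sum>i\<in>I. (x \<bullet> i)\<^sup>2)) \<le> (norm x)\<^sup>2"
        using \<open>s\<^sup>2 - t\<^sup>2 \<le> 0\<close> by (intro key mult_nonpos_nonneg) (simp_all add: al)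
    qed (simp add: aligned_normalize)
    then show "emeasure unif_sphere {u. aligned a u V} \<le> bound"
      using bound by (simp add: emeasure_unif_sphere_aligned_rotate[OF T(1), of a V] T(2))
  }
qed

section \<open>Random directions and a fixed vector\<close>

text \<open>Coefficients are indexed by \<open>I\<close> rather than by vectors, so the formula is
  uniform in \<open>v\<close> even when \<open>v\<close> repeats a value.\<close>

lemma span_image_eq_sums:
  assumes "finite I"
  shows "span (v ` I) = range (\<lambda>c. \<Sum>i\<in>I. c i *\<^sub>R (v i :: 'a::real_vector))"
proof
  let ?R = "range (\<lambda>c. \<Sum>i\<in>I. c i *\<^sub>R v i)"
  have "subspace ?R"
  proof (rule subspaceI)
    show "0 \<in> ?R" by (rule image_eqI[of _ _ "\<lambda>_. 0"]) simp_all
  next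
    fix x y assume "x \<in> ?R" "y \<in> ?R"
    then obtain c c' where "x = (\<Sum>i\<in>I. c i *\<^sub>R v i)" "y = (\<Sum>i\<in>I. c' i *\<^sub>R v i)" by blast
    then show "x + y \<in> ?R"
      by (intro image_eqI[of _ _ "\<lambda>i. c i + c' i"]) (simp_all add: scaleR_add_left sum.distrib)
  next
    fix k x assume "x \<in> ?R"
    then obtain c where "x = (\<Sum>i\<in>I. c i *\<^sub>R v i)" by blast
    then show "k *\<^sub>R x \<in> ?R"
      by (intro image_eqI[of _ _ "\<lambda>i. k * c i"]) (simp_all add: scaleR_sum_right)
  qed
  moreover have "v ` I \<subseteq> ?R"
  proof
    fix x assume "x \<in> v ` I"
    then obtain j where j: "j \<in> I" "x = v j" by blast
    have "(\<Sum>i\<in>I. (if i = j then 1 else 0) *\<^sub>R v i) = (\<Sum>i\<in>I. if i = j then v i else 0)"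
      by (intro sum.cong) auto
    also have "\<dots> = x" using assms j by simp
    finally have "x = (\<Sum>i\<in>I. (if i = j then 1 else 0) *\<^sub>R v i)" by (rule sym)
    then show "x \<in> ?R" by (rule image_eqI[where x="\<lambda>i. if i = j then 1 else 0"]) simp
  qed
  ultimately show "span (v ` I) \<subseteq> ?R" by (rule span_minimal[rotated])
  show "?R \<subseteq> span (v ` I)" by (auto intro: span_sum span_mul span_base)
qed

text \<open>Real coefficients are limits of rational ones, and an open condition that holds in the
  limit already holds for some approximation. The uncountable quantifier over the span becomes a
  countable one that does not depend on \<open>v\<close>.\<close>

lemma Bex_span_open_iff_rational:
  fixes v :: "'i \<Rightarrow> 'a::real_normed_vector"
  assumes I: "finite I" and G: "open G"
  shows "(\<exists>w\<in>span (v ` I). (u, w) \<in> G)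
    \<longleftrightarrow> (\<exists>q\<in>I \<rightarrow>\<^sub>E \<rat>. (u, \<Sum>i\<in>I. q i *\<^sub>R v i) \<in> G)"
proof
  assume "\<exists>w\<in>span (v ` I). (u, w) \<in> G"
  then obtain c where c: "(u, \<Sum>i\<in>I. c i *\<^sub>R v i) \<in> G"
    by (auto simp: span_image_eq_sums[OF I])
  have "\<exists>q\<in>\<rat>. \<bar>q - c i\<bar> < inverse (real (Suc n))" for i n
  proof -
    obtain q where "q \<in> \<rat>" "c i < q" "q < c i + inverse (real (Suc n))"
      using Rats_dense_in_real[of "c i" "c i + inverse (real (Suc n))"] by auto
    then show ?thesis by (intro bexI[of _ q]) auto
  qed
  then have "\<forall>n. \<exists>r. \<forall>i. r i \<in> \<rat> \<and> \<bar>r i - c i\<bar> < inverse (real (Suc n))"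
    by (intro allI choice) auto
  from choice[OF this] obtain q
    where q: "\<And>n i. q n i \<in> \<rat>" "\<And>n i. \<bar>q n i - c i\<bar> < inverse (real (Suc n))"
    by blast
  have "(\<lambda>n. q n i) \<longlonglongrightarrow> c i" for i
  proof (rule LIM_zero_cancel, rule Lim_null_comparison[OF _ LIMSEQ_inverse_real_of_nat])
    show "\<forall>\<^sub>F n in sequentially. norm (q n i - c i) \<le> inverse (real (Suc n))"
      using q(2) by (intro always_eventually) (auto intro: less_imp_le)
  qed
  then have "(\<lambda>n. (u, \<Sum>i\<in>I. q n i *\<^sub>R v i)) \<longlonglongrightarrow> (u, \<Sum>i\<in>I. c i *\<^sub>R v i)"
    by (intro tendsto_intros)
  then have "\<forall>\<^sub>F n in sequentially. (u, \<Sum>i\<in>I. q n i *\<^sub>R v i) \<in> G"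
    using G c by (rule topological_tendstoD)
  then obtain n where "(u, \<Sum>i\<in>I. q n i *\<^sub>R v i) \<in> G"
    by (auto simp: eventually_sequentially)
  \<comment> \<open>Restricting the coefficients to \<open>I\<close> leaves the sum unchanged and
    lands in the extensional functions, of which there are only countably many.\<close>
  then show "\<exists>q\<in>I \<rightarrow>\<^sub>E \<rat>. (u, \<Sum>i\<in>I. q i *\<^sub>R v i) \<in> G"
    using q(1) by (intro bexI[of _ "restrict (q n) I"]) auto
next
  assume "\<exists>q\<in>I \<rightarrow>\<^sub>E \<rat>. (u, \<Sum>i\<in>I. q i *\<^sub>R v i) \<in> G"
  then show "\<exists>w\<in>span (v ` I). (u, w) \<in> G"
    by (auto simp: span_image_eq_sums[OF I])
qed

lemma sets_Collect_Bex_span: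
  fixes f :: "'x \<Rightarrow> 'b::euclidean_space" and v :: "'x \<Rightarrow> 'i \<Rightarrow> 'a::euclidean_space"
  assumes I: "finite I" and G: "open G" and f: "f \<in> borel_measurable M"
    and v: "\<And>i. i \<in> I \<Longrightarrow> (\<lambda>x. v x i) \<in> borel_measurable M"
  shows "{x \<in> space M. \<exists>w\<in>span (v x ` I). (f x, w) \<in> G} \<in> sets M"
proof -
  have "countable (I \<rightarrow>\<^sub>E (\<rat> :: real set))"
    using I by (intro countable_PiE) (auto intro: countable_rat)
  moreover have "{x \<in> space M. (f x, \<Sum>i\<in>I. q i *\<^sub>R v x i) \<in> G} \<in> sets M" for q
  proof -
    have "(\<lambda>x. (f x, \<Sum>i\<in>I. q i *\<^sub>R v x i)) \<in> borel_measurable M"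
      using f v by (intro borel_measurable_Pair borel_measurable_sum borel_measurable_scaleR) auto
    from measurable_sets[OF this borel_open[OF G]] show ?thesis
      by (simp add: vimage_def Int_def conj_commute)
  qed
  ultimately have "{x \<in> space M. \<exists>q\<in>I \<rightarrow>\<^sub>E \<rat>. (f x, \<Sum>i\<in>I. q i *\<^sub>R v x i) \<in> G} \<in> sets M"
    by (intro sets.sets_Collect_countable_Ex') auto
  then show ?thesis by (simp add: Bex_span_open_iff_rational[OF I G])
qed

lemma sets_Collect_aligned_span:
  fixes f :: "'x \<Rightarrow> 'a::euclidean_space"
  assumes "finite I" "f \<in> borel_measurable M" "\<And>i. i \<in> I \<Longrightarrow> (\<lambda>x. v x i) \<in> borel_measurable M"
  shows "{x \<in> space M. aligned a (f x) (span (v x ` I))} \<in> sets M"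
proof -
  have "open {p::'a \<times> 'a. a * norm (fst p) * norm (snd p) < fst p \<bullet> snd p}"
    by (intro open_Collect_less continuous_intros)
  from sets_Collect_Bex_span[OF assms(1) this assms(2,3)] show ?thesis
    by (simp add: aligned_def)
qed

text \<open>A span is closed, so membership means having points of the span within every distance
  \<open>inverse (Suc n)\<close>: a countable intersection of events given by open
  conditions.\<close>

lemma sets_Collect_in_span:
  fixes f :: "'x \<Rightarrow> 'a::euclidean_space"
  assumes "finite I" "f \<in> borel_measurable M" "\<And>i. i \<in> I \<Longrightarrow> (\<lambda>x. v x i) \<in> borel_measurable M"
  shows "{x \<in> space M. f x \<in> span (v x ` I)} \<in> sets M"
proof -
  have "f x \<in> span (v x ` I) \<longleftrightarrow>
      (\<forall>n. \<exists>w\<in>span (v x ` I). (f x, w) \<in> {p. dist (snd p) (fst p) < inverse (real (Suc n))})" for x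
  proof -
    have "f x \<in> span (v x ` I) \<longleftrightarrow> f x \<in> closure (span (v x ` I))"
      by (simp add: closure_closed closed_subspace)
    also have "\<dots> \<longleftrightarrow> (\<forall>n. \<exists>w\<in>span (v x ` I). dist w (f x) < inverse (real (Suc n)))"
      unfolding closure_approachable
    proof (intro iffI allI impI)
      fix e :: real assume "e > 0"
      then obtain n where n: "inverse (real (Suc n)) < e" using reals_Archimedean by blast
      assume "\<forall>n. \<exists>w\<in>span (v x ` I). dist w (f x) < inverse (real (Suc n))"
      then obtain w where "w \<in> span (v x ` I)" "dist w (f x) < inverse (real (Suc n))" by blast
      with n show "\<exists>w\<in>span (v x ` I). dist w (f x) < e" by (meson less_trans)
    qed simp
    finally show ?thesis by simp
  qed
  moreover have "{x \<in> space M. \<exists>w\<in>span (v x ` I). (f x, w)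
      \<in> {p. dist (snd p) (fst p) < inverse (real (Suc n))}} \<in> sets M" for n
    using assms by (intro sets_Collect_Bex_span open_Collect_less continuous_intros)
  ultimately show ?thesis
    by (simp only: sets.sets_Collect_countable_All)
qed

section \<open>Almost sure dimension of the random span\<close>

lemma product_prob_space_unif_sphere: "product_prob_space (\<lambda>_. unif_sphere :: (real^'n) measure)"
  by (simp add: product_prob_space_def product_prob_space_axioms_def product_sigma_finite_def
      prob_space_unif_sphere prob_space_imp_sigma_finite)

lemma measurable_PiM_unif_sphere_component:
  assumes "i \<in> I"
  shows "(\<lambda>v. v i) \<in> borel_measurable (PiM I (\<lambda>_. unif_sphere :: (real^'n) measure))"
  using measurable_component_singleton[OF assms, of "\<lambda>_. unif_sphere :: (real^'n) measure"]
  by (simp cong: measurable_cong_sets)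

text \<open>By Fubini the other directions may be frozen. They span a subspace of dimension at most
  \<open>card I - 1 < CARD('n)\<close>, which the remaining direction hits with probability
  0.\<close>

lemma AE_PiM_unif_sphere_not_in_span:
  assumes I: "finite I" "i \<in> I" and card: "card I \<le> CARD('n)"
  shows "AE v in PiM I (\<lambda>_. unif_sphere :: (real^'n) measure). v i \<notin> span (v ` (I - {i}))"
proof -
  interpret product_prob_space "\<lambda>_. unif_sphere :: (real^'n) measure"
    by (rule product_prob_space_unif_sphere)
  let ?M = "\<lambda>I. PiM I (\<lambda>_. unif_sphere :: (real^'n) measure)"
  define J where "J = I - {i}"
  have J: "finite J" "i \<notin> J" "insert i J = I" "card J < CARD('n)"
    using I card card_Diff1_less[of I i] by (auto simp: J_def)
  let ?N = "{v \<in> space (?M I). v i \<in> span (v ` J)}"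
  have N: "?N \<in> sets (?M I)"
    using J by (intro sets_Collect_in_span measurable_PiM_unif_sphere_component) auto
  have "emeasure (?M I) ?N = (\<integral>\<^sup>+v. indicator ?N v \<partial>?M I)"
    using N by simp
  also have "\<dots> = (\<integral>\<^sup>+x. (\<integral>\<^sup>+y. indicator ?N (x(i := y)) \<partial>unif_sphere) \<partial>?M J)"
    using product_nn_integral_insert[OF J(1,2), of "indicator ?N"] N J(3)
    by (simp add: borel_measurable_indicator)
  also have "\<dots> = (\<integral>\<^sup>+x. 0 \<partial>?M J)"
  proof (rule nn_integral_cong)
    fix x assume "x \<in> space (?M J)"
    have meas: "span (x ` J) \<in> sets borel" by (intro borel_closed closed_subspace subspace_span)
    have "(x(i := y)) ` J = x ` J" for y using J(2) by auto
    then have "(\<integral>\<^sup>+y. indicator ?N (x(i := y)) \<partial>unif_sphere)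
        \<le> (\<integral>\<^sup>+y. indicator (span (x ` J)) y \<partial>unif_sphere)"
      by (intro nn_integral_mono) (auto simp: indicator_def)
    also have "\<dots> = emeasure unif_sphere (span (x ` J))"
      using meas by simp
    also have "\<dots> = 0"
    proof (rule emeasure_unif_sphere_subspace)
      have "dim (span (x ` J)) \<le> card (x ` J)" using J(1) by (simp add: dim_le_card')
      also have "\<dots> \<le> card J" using J(1) by (rule card_image_le)
      finally show "dim (span (x ` J)) < CARD('n)" using J(4) by simp
    qed simp
    finally show "(\<integral>\<^sup>+y. indicator ?N (x(i := y)) \<partial>unif_sphere) = 0" by simp
  qed
  finally have "?N \<in> null_sets (?M I)" using N by (simp add: null_sets_def)
  then show ?thesis unfolding J_def[symmetric] by (rule AE_I'[rotated 0]) auto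
qed

lemma AE_PiM_unif_sphere_dim_span:
  assumes I: "finite I" and card: "card I \<le> CARD('n)"
  shows "AE v in PiM I (\<lambda>_. unif_sphere :: (real^'n) measure). dim (span (v ` I)) = card I"
proof -
  have "AE v in PiM I (\<lambda>_. unif_sphere :: (real^'n) measure). \<forall>i\<in>I. v i \<notin> span (v ` (I - {i}))"
    using I card by (intro AE_finite_allI AE_PiM_unif_sphere_not_in_span)
  then show ?thesis
  proof eventually_elim
    case (elim v)
    have inj: "inj_on v I"
    proof (rule inj_onI, rule ccontr)
      fix i j assume ij: "i \<in> I" "j \<in> I" "v i = v j" "i \<noteq> j"
      then have "v i \<in> span (v ` (I - {i}))" by (auto intro!: span_base)
      with elim ij(1) show False by blast
    qed
    have "independent (v ` I)"
      unfolding dependent_def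
    proof clarsimp
      fix i assume i: "i \<in> I" "v i \<in> span (v ` I - {v i})"
      have "v ` I - {v i} \<subseteq> v ` (I - {i})" by auto
      with i elim show False using span_mono by blast
    qed
    then show ?case using inj by (simp add: dim_eq_card_independent card_image)
  qed
qed

section \<open>Rotation invariance of the random family and averaging\<close>

text \<open>The two measures agree on boxes, because the preimage of a box is a box and each factor
  is invariant. The restriction to \<open>I\<close> keeps the values extensional, as points of the
  product space must be.\<close>

lemma PiM_unif_sphere_distr_orthogonal_transformation:
  fixes T :: "real^'n \<Rightarrow> real^'n" and I :: "'i set"
  assumes T: "orthogonal_transformation T" and I: "finite I"
  defines "M \<equiv> PiM I (\<lambda>_. unif_sphere :: (real^'n) measure)"
  shows "(\<lambda>v. \<lambda>i\<in>I. T (v i)) \<in> measurable M M"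
    and "distr M M (\<lambda>v. \<lambda>i\<in>I. T (v i)) = M"
proof -
  interpret product_prob_space "\<lambda>_::'i. unif_sphere :: (real^'n) measure"
    by (rule product_prob_space_unif_sphere)
  have Tm: "T \<in> measurable unif_sphere unif_sphere"
    using borel_measurable_orthogonal_transformation[OF T] by (simp cong: measurable_cong_sets)
  show meas: "(\<lambda>v. \<lambda>i\<in>I. T (v i)) \<in> measurable M M"
    unfolding M_def
    by (intro measurable_restrict measurable_compose[OF _ Tm] measurable_component_singleton)
  show "distr M M (\<lambda>v. \<lambda>i\<in>I. T (v i)) = M"
    unfolding M_def
  proof (rule PiM_eqI[OF I])
    fix A :: "'i \<Rightarrow> (real^'n) set"
    assume A: "\<And>i. i \<in> I \<Longrightarrow> A i \<in> sets unif_sphere"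
    have TA: "T -` A i \<in> sets unif_sphere" if "i \<in> I" for i
      using measurable_sets[OF Tm A[OF that]] by simp
    have "(\<lambda>v. \<lambda>i\<in>I. T (v i)) -` (Pi\<^sub>E I A) \<inter> space M = (\<Pi>\<^sub>E i\<in>I. T -` A i)"
      by (auto simp: M_def space_PiM PiE_iff extensional_def)
    then have "emeasure (distr M M (\<lambda>v. \<lambda>i\<in>I. T (v i))) (Pi\<^sub>E I A)
        = emeasure M (\<Pi>\<^sub>E i\<in>I. T -` A i)"
      using A by (subst emeasure_distr[OF meas]) (auto simp: M_def intro!: sets_PiM_I_finite I)
    also have "\<dots> = (\<Prod>i\<in>I. emeasure unif_sphere (T -` A i))"
      unfolding M_def using TA by (intro emeasure_PiM I)
    also have "\<dots> = (\<Prod>i\<in>I. emeasure unif_sphere (A i))"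
    proof (rule prod.cong)
      fix i assume "i \<in> I"
      then have "emeasure (distr unif_sphere borel T) (A i) = emeasure unif_sphere (T -` A i)"
        using A Tm by (subst emeasure_distr) (auto cong: measurable_cong_sets)
      then show "emeasure unif_sphere (T -` A i) = emeasure unif_sphere (A i)"
        by (simp add: unif_sphere_distr_orthogonal_transformation[OF T])
    qed simp
    finally show "emeasure (distr (PiM I (\<lambda>_. unif_sphere)) (PiM I (\<lambda>_. unif_sphere)) (\<lambda>v. \<lambda>i\<in>I. T (v i)))
        (Pi\<^sub>E I A) = (\<Prod>i\<in>I. emeasure unif_sphere (A i))"
      by (simp add: M_def)
  qed simp
qed

text \<open>A fixed direction and a random subspace may be traded for a random direction: by rotation
  invariance the left-hand side does not depend on \<open>z \<noteq> 0\<close>, so it can be averaged over the sphere.\<close>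

lemma emeasure_PiM_unif_sphere_average:
  fixes Q :: "real^'n \<Rightarrow> (real^'n) set \<Rightarrow> bool" and I :: "'i set" and z :: "real^'n"
  defines "M \<equiv> PiM I (\<lambda>_. unif_sphere :: (real^'n) measure)"
  assumes I: "finite I" and z: "z \<noteq> 0"
    and meas: "{x \<in> space (M \<Otimes>\<^sub>M unif_sphere). Q (snd x) (span (fst x ` I))} \<in> sets (M \<Otimes>\<^sub>M unif_sphere)"
    and rot: "\<And>T u S. orthogonal_transformation T \<Longrightarrow> Q (T u) (T ` S) \<longleftrightarrow> Q u S"
    and scale: "\<And>c u S. c > 0 \<Longrightarrow> Q (c *\<^sub>R u) S \<longleftrightarrow> Q u S"
  shows "emeasure M {v \<in> space M. Q z (span (v ` I))}
    = (\<integral>\<^sup>+v. emeasure unif_sphere {u. Q u (span (v ` I))} \<partial>M)"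
proof -
  interpret S: prob_space "unif_sphere :: (real^'n) measure" by (rule prob_space_unif_sphere)
  interpret M: prob_space M unfolding M_def by (rule prob_space_PiM) (rule prob_space_unif_sphere)
  interpret MS: pair_sigma_finite M "unif_sphere :: (real^'n) measure" ..
  let ?X = "{x \<in> space (M \<Otimes>\<^sub>M unif_sphere). Q (snd x) (span (fst x ` I))}"
  define p where "p u = emeasure M {v \<in> space M. Q u (span (v ` I))}" for u
  have slice2: "(\<lambda>v. (v, u)) -` ?X = {v \<in> space M. Q u (span (v ` I))}" for u
    by (auto simp: space_pair_measure)
  have slice1: "Pair v -` ?X = {u. Q u (span (v ` I))}" if "v \<in> space M" for v
    using that by (auto simp: space_pair_measure)
  have sets2: "{v \<in> space M. Q u (span (v ` I))} \<in> sets M" for u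
    using sets_Pair2[OF meas, of u] by (simp only: slice2)
  have p_rot: "p (T u) = p u" if T: "orthogonal_transformation T" for T u
  proof -
    note D = PiM_unif_sphere_distr_orthogonal_transformation[OF T I, folded M_def]
    have img: "(\<lambda>i\<in>I. T (v i)) ` I = T ` v ` I" for v by auto
    have "p (T u) = emeasure (distr M M (\<lambda>v. \<lambda>i\<in>I. T (v i))) {v \<in> space M. Q (T u) (span (v ` I))}"
      by (simp add: D(2) p_def)
    also have "\<dots> = emeasure M {v \<in> space M. Q (T u) (T ` span (v ` I))}"
    proof -
      have "(\<lambda>v. \<lambda>i\<in>I. T (v i)) -` {v \<in> space M. Q (T u) (span (v ` I))} \<inter> space M
          = {v \<in> space M. Q (T u) (T ` span (v ` I))}"
        using measurable_space[OF D(1)]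
        by (auto simp only: img linear_span_image[OF orthogonal_transformation_linear[OF T]]
            vimage_def Int_iff mem_Collect_eq)
      then show ?thesis by (simp only: emeasure_distr[OF D(1) sets2])
    qed
    also have "\<dots> = p u" by (simp add: rot[OF T] p_def)
    finally show ?thesis .
  qed
  \<comment> \<open>Rescaled to the length of \<open>z\<close>, the vector \<open>u\<close> is the
    image of \<open>z\<close> under a rotation.\<close>
  have p_eq: "p u = p z" if "u \<noteq> 0" for u
  proof -
    let ?c = "norm z / norm u"
    have "?c > 0" using that z by simp
    moreover have "norm z = norm (?c *\<^sub>R u)" using that by simp
    then obtain T where "orthogonal_transformation T" "T z = ?c *\<^sub>R u"
      by (rule orthogonal_transformation_exists)
    ultimately have "p z = p (?c *\<^sub>R u)" using p_rot by metis
    then show ?thesis using scale[OF \<open>?c > 0\<close>] by (simp add: p_def)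
  qed
  \<comment> \<open>\<open>unif_sphere\<close> lives on the whole space, so the origin, where
    \<open>p\<close> may take another value, has to be discarded as a null set.\<close>
  have "emeasure unif_sphere {0::real^'n} = 0"
    by (rule emeasure_unif_sphere_subspace) (simp_all add: subspace_0)
  then have AE0: "AE u in unif_sphere. (u::real^'n) \<noteq> 0"
    by (intro AE_I[where N="{0}"]) auto
  \<comment> \<open>The constant \<open>p z\<close> is averaged over the sphere; computing the
    measure of \<open>?X\<close> by both kinds of slices exchanges the roles of \<open>u\<close> and
    \<open>v\<close>.\<close>
  have "p z = (\<integral>\<^sup>+u. p z \<partial>(unif_sphere :: (real^'n) measure))" by (simp add: S.emeasure_space_1[simplified])
  also have "\<dots> = (\<integral>\<^sup>+u. p u \<partial>unif_sphere)"
    using AE0 by (intro nn_integral_cong_AE) (auto simp: p_eq)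
  also have "\<dots> = emeasure (M \<Otimes>\<^sub>M unif_sphere) ?X"
    by (simp only: MS.emeasure_pair_measure_alt2[OF meas] slice2 p_def)
  also have "\<dots> = (\<integral>\<^sup>+v. emeasure unif_sphere (Pair v -` ?X) \<partial>M)"
    by (rule S.emeasure_pair_measure_alt[OF meas])
  also have "\<dots> = (\<integral>\<^sup>+v. emeasure unif_sphere {u. Q u (span (v ` I))} \<partial>M)"
    by (intro nn_integral_cong) (simp only: slice1)
  finally show ?thesis by (simp add: p_def)
qed

section \<open>The affine classifier\<close>

lemma prob_space_rand_dirs: "prob_space (rand_dirs m :: (nat \<Rightarrow> real^'n) measure)"
  unfolding rand_dirs_def by (intro prob_space_PiM prob_space_unif_sphere)

lemma rand_dirs_component_measurable:
  "i < m \<Longrightarrow> (\<lambda>v. v i) \<in> borel_measurable (rand_dirs m :: (nat \<Rightarrow> real^'n) measure)"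
  unfolding rand_dirs_def by (rule measurable_PiM_unif_sphere_component) simp

lemma sets_rand_dirs_aligned:
  "{v \<in> space (rand_dirs m). aligned a (z::real^'n) (span (v ` {..<m}))} \<in> sets (rand_dirs m)"
  by (intro sets_Collect_aligned_span rand_dirs_component_measurable) auto

lemma
  fixes z :: "real^'n"
  assumes z: "z \<noteq> 0"
  shows emeasure_rand_dirs_aligned:
    "emeasure (rand_dirs m) {v \<in> space (rand_dirs m). aligned a z (span (v ` {..<m}))}
      = (\<integral>\<^sup>+v. emeasure unif_sphere {u::real^'n. aligned a u (span (v ` {..<m}))} \<partial>rand_dirs m)"
    and emeasure_rand_dirs_not_aligned:
    "emeasure (rand_dirs m) {v \<in> space (rand_dirs m). \<not> aligned a z (span (v ` {..<m}))}
      = (\<integral>\<^sup>+v. emeasure unif_sphere {u::real^'n. \<not> aligned a u (span (v ` {..<m}))} \<partial>rand_dirs m)"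
proof -
  let ?P = "rand_dirs m \<Otimes>\<^sub>M (unif_sphere :: (real^'n) measure)"
  have snd: "snd \<in> borel_measurable ?P"
    using measurable_snd[of "rand_dirs m" "unif_sphere :: (real^'n) measure"]
    by (simp cong: measurable_cong_sets)
  have fst: "(\<lambda>x. fst x i) \<in> borel_measurable ?P" if "i \<in> {..<m}" for i
    using measurable_compose[OF measurable_fst rand_dirs_component_measurable] that by simp
  have meas: "{x \<in> space ?P. aligned a (snd x) (span (fst x ` {..<m}))} \<in> sets ?P"
    by (intro sets_Collect_aligned_span snd fst) simp_all
  have meas': "{x \<in> space ?P. \<not> aligned a (snd x) (span (fst x ` {..<m}))} \<in> sets ?P"
    using meas by (rule sets.sets_Collect_neg)
  show "emeasure (rand_dirs m) {v \<in> space (rand_dirs m). aligned a z (span (v ` {..<m}))}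
      = (\<integral>\<^sup>+v. emeasure unif_sphere {u::real^'n. aligned a u (span (v ` {..<m}))} \<partial>rand_dirs m)"
    using emeasure_PiM_unif_sphere_average[of "{..<m}" z "aligned a"] z meas
    by (simp add: rand_dirs_def aligned_scaleR aligned_orthogonal_transformation)
  show "emeasure (rand_dirs m) {v \<in> space (rand_dirs m). \<not> aligned a z (span (v ` {..<m}))}
      = (\<integral>\<^sup>+v. emeasure unif_sphere {u::real^'n. \<not> aligned a u (span (v ` {..<m}))} \<partial>rand_dirs m)"
    using emeasure_PiM_unif_sphere_average[of "{..<m}" z "\<lambda>u S. \<not> aligned a u S"] z meas'
    by (simp add: rand_dirs_def aligned_scaleR aligned_orthogonal_transformation)
qed

text \<open>Averaging expresses the probability as a mean over \<open>v\<close> of cone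
  probabilities for the subspace spanned by \<open>v\<close>. This subspace almost surely has
  dimension \<open>m\<close>, and then the bound for a fixed subspace is the same for every
  \<open>v\<close>.\<close>

lemma
  fixes z :: "real^'n" and \<beta> :: real and m :: nat
  defines "a \<equiv> sqrt (\<beta> * real m / real CARD('n))"
    and "bound \<equiv> exp (real m / 2 * (1 - \<beta> + ln \<beta>))"
  assumes z: "z \<noteq> 0" and m: "m < CARD('n)" and \<beta>: "\<beta> > 0"
  shows rand_dirs_lower_tail: "\<beta> \<le> 1 \<Longrightarrow>
      measure (rand_dirs m) {v \<in> space (rand_dirs m). \<not> aligned a z (span (v ` {..<m}))} \<le> bound"
    and rand_dirs_upper_tail: "\<beta> \<ge> 1 \<Longrightarrow>
      measure (rand_dirs m) {v \<in> space (rand_dirs m). aligned a z (span (v ` {..<m}))} \<le> bound"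
proof -
  interpret prob_space "rand_dirs m :: (nat \<Rightarrow> real^'n) measure" by (rule prob_space_rand_dirs)
  have dim: "AE v in rand_dirs m. dim (span (v ` {..<m}) :: (real^'n) set) = m"
    unfolding rand_dirs_def using AE_PiM_unif_sphere_dim_span[of "{..<m}", where 'n='n] m by simp
  have bound: "bound \<ge> 0" by (simp add: bound_def)
  have int: "(\<integral>\<^sup>+v. F v \<partial>(rand_dirs m :: (nat \<Rightarrow> real^'n) measure)) \<le> ennreal bound"
    if "\<And>v. dim (span (v ` {..<m}) :: (real^'n) set) = m \<Longrightarrow> F v \<le> ennreal bound" for F
  proof -
    have "(\<integral>\<^sup>+v. F v \<partial>(rand_dirs m :: (nat \<Rightarrow> real^'n) measure))
        \<le> (\<integral>\<^sup>+v. ennreal bound \<partial>(rand_dirs m :: (nat \<Rightarrow> real^'n) measure))"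
      using dim by (intro nn_integral_mono_AE) (auto elim!: eventually_mono intro: that)
    then show ?thesis by (simp add: emeasure_space_1)
  qed
  {
    assume le: "\<beta> \<le> 1"
    have \<beta>m: "\<beta> * real m < real CARD('n)"
      using mult_right_mono[OF le, of "real m"] m by simp
    have "emeasure unif_sphere {u. \<not> aligned a u (span (v ` {..<m}))} \<le> ennreal bound"
      if "dim (span (v ` {..<m}) :: (real^'n) set) = m" for v
      using unif_sphere_lower_tail[of "span (v ` {..<m})" \<beta>] that \<beta> \<beta>m m le
      unfolding a_def bound_def that by simp
    from int[of "\<lambda>v. emeasure unif_sphere {u. \<not> aligned a u (span (v ` {..<m}))}", OF this]
    show "measure (rand_dirs m) {v \<in> space (rand_dirs m). \<not> aligned a z (span (v ` {..<m}))} \<le> bound"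
      unfolding emeasure_rand_dirs_not_aligned[OF z, symmetric] emeasure_eq_measure
      using bound by simp
  next
    assume ge: "\<beta> \<ge> 1"
    show "measure (rand_dirs m) {v \<in> space (rand_dirs m). aligned a z (span (v ` {..<m}))} \<le> bound"
    proof (cases "\<beta> * real m < real CARD('n)")
      case True
      have "emeasure unif_sphere {u. aligned a u (span (v ` {..<m}))} \<le> ennreal bound"
        if "dim (span (v ` {..<m}) :: (real^'n) set) = m" for v
        using unif_sphere_upper_tail[of "span (v ` {..<m})" \<beta>] that \<beta> True m ge
        unfolding a_def bound_def that by simp
      from int[of "\<lambda>v. emeasure unif_sphere {u. aligned a u (span (v ` {..<m}))}", OF this] show ?thesis
        unfolding emeasure_rand_dirs_aligned[OF z, symmetric] emeasure_eq_measure
        using bound by simp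
    next
      case False
      \<comment> \<open>The threshold has reached the full length of the vector, so the event is
        empty.\<close>
      then have "a \<ge> 1" by (simp add: a_def)
      then show ?thesis using bound by (simp add: not_aligned_ge_1)
    qed
  }
qed

section \<open>Minimal perturbations of an affine classifier\<close>

text \<open>With \<open>z = W k - W khat\<close> and margin \<open>c\<close>, a perturbation
  \<open>r\<close> reaches class \<open>k\<close> iff \<open>z \<bullet> r \<ge> c\<close>. The
  witness \<open>w\<close> of alignment, scaled to give equality, has norm
  \<open>c * norm w / (z \<bullet> w)\<close>, and alignment bounds this quotient.\<close>

lemma rk_S_affine_clf_le:
  fixes W :: "nat \<Rightarrow> real^'n"
  assumes S: "subspace S" and a: "a > 0" and gap: "affine_clf W b k x0 < affine_clf W b khat x0"
    and al: "aligned a (W k - W khat) S"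
  shows "rk_S (affine_clf W b) S x0 khat k
    \<le> ereal ((affine_clf W b khat x0 - affine_clf W b k x0) / (a * norm (W k - W khat)))"
proof -
  define z where "z = W k - W khat"
  define c where "c = affine_clf W b khat x0 - affine_clf W b k x0"
  have c: "c > 0" using gap by (simp add: c_def)
  obtain w where w: "w \<in> S" "a * norm z * norm w < z \<bullet> w"
    using al by (auto simp: aligned_def z_def)
  moreover have "0 \<le> a * norm z * norm w" using a by simp
  ultimately have zw: "0 < z \<bullet> w" by linarith
  then have z: "norm z > 0" by auto
  define r where "r = (c / (z \<bullet> w)) *\<^sub>R w"
  have "z \<bullet> r = c" using zw by (simp add: r_def)
  then have "affine_clf W b k (x0 + r) \<ge> affine_clf W b khat (x0 + r)"
    by (simp add: affine_clf_def z_def c_def inner_diff_left inner_add_right)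
  moreover have "r \<in> S" using S w by (simp add: r_def subspace_mul)
  ultimately have "rk_S (affine_clf W b) S x0 khat k \<le> ereal (norm r)"
    unfolding rk_S_def by (intro Inf_lower) blast
  also have "norm r \<le> c / (a * norm z)"
  proof -
    have "norm r * (a * norm z) = c * (a * norm z * norm w) / (z \<bullet> w)"
      using c zw by (simp add: r_def)
    also have "\<dots> \<le> c * (z \<bullet> w) / (z \<bullet> w)"
      using w c zw by (intro divide_right_mono mult_left_mono) auto
    finally show ?thesis using zw a z by (simp add: pos_le_divide_eq)
  qed
  finally show ?thesis by (simp add: z_def c_def)
qed

text \<open>A perturbation in \<open>S\<close> that reaches class \<open>k\<close> has inner product
  with \<open>W k - W khat\<close> at least the margin, while non-alignment caps this inner product
  by \<open>a * norm (W k - W khat) * norm r\<close>.\<close>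

lemma rk_S_affine_clf_ge:
  fixes W :: "nat \<Rightarrow> real^'n"
  assumes a: "a > 0" and z: "W k \<noteq> W khat" and al: "\<not> aligned a (W k - W khat) S"
  shows "ereal ((affine_clf W b khat x0 - affine_clf W b k x0) / (a * norm (W k - W khat)))
    \<le> rk_S (affine_clf W b) S x0 khat k"
  unfolding rk_S_def
proof (rule Inf_greatest, clarify)
  fix r assume r: "r \<in> S" "affine_clf W b khat (x0 + r) \<le> affine_clf W b k (x0 + r)"
  then have "affine_clf W b khat x0 - affine_clf W b k x0 \<le> (W k - W khat) \<bullet> r"
    by (simp add: affine_clf_def inner_diff_left inner_add_right)
  also have "\<dots> \<le> a * norm (W k - W khat) * norm r"
    using al r(1) by (auto simp: aligned_def not_less)
  finally show "ereal ((affine_clf W b khat x0 - affine_clf W b k x0) / (a * norm (W k - W khat)))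
      \<le> ereal (norm r)"
    using a z by (simp add: pos_divide_le_eq mult.commute)
qed

text \<open>The perpendicular step to the separating hyperplane attains the bound; no shorter step
  works, by Cauchy-Schwarz in the form of non-alignment with \<open>a = 1\<close>.\<close>

lemma rk_S_affine_clf_UNIV:
  fixes W :: "nat \<Rightarrow> real^'n"
  assumes z: "W k \<noteq> W khat" and gap: "affine_clf W b k x0 < affine_clf W b khat x0"
  shows "rk_S (affine_clf W b) UNIV x0 khat k
    = ereal ((affine_clf W b khat x0 - affine_clf W b k x0) / norm (W k - W khat))"
proof (rule antisym)
  define z where "z = W k - W khat"
  define c where "c = affine_clf W b khat x0 - affine_clf W b k x0"
  define r where "r = (c / (norm z)\<^sup>2) *\<^sub>R z"
  have "norm z > 0" "c > 0" using assms by (auto simp: z_def c_def)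
  then have "z \<bullet> r = c" "norm r = c / norm z"
    by (auto simp: r_def power2_norm_eq_inner[symmetric] power2_eq_square)
  then show "rk_S (affine_clf W b) UNIV x0 khat k
      \<le> ereal ((affine_clf W b khat x0 - affine_clf W b k x0) / norm (W k - W khat))"
    unfolding rk_S_def c_def[symmetric] z_def[symmetric]
    by (intro Inf_lower CollectI exI[of _ r])
      (simp add: affine_clf_def z_def c_def inner_diff_left inner_add_right)
  show "ereal ((affine_clf W b khat x0 - affine_clf W b k x0) / norm (W k - W khat))
      \<le> rk_S (affine_clf W b) UNIV x0 khat k"
    using rk_S_affine_clf_ge[OF zero_less_one z not_aligned_ge_1] by simp
qed

section \<open>Estimates of the exponents at \<open>zeta1\<close> and \<open>zeta2\<close>\<close>

text \<open>With \<open>s\<^sup>2 = ln (1 / \<delta>) / m\<close>, \<open>\<beta>\<close> is the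
  quadratic Taylor polynomial of \<open>exp (2 * s)\<close>. Hence
  \<open>ln \<beta> \<le> 2 * s\<close>, and the exponent is at most
  \<open>- m * s\<^sup>2 = ln \<delta>\<close>.\<close>

lemma upper_tail_exponent:
  fixes \<delta> :: real
  assumes "m \<ge> 1" "0 < \<delta>" "\<delta> < 1"
  defines "\<beta> \<equiv> inverse (zeta1 m \<delta>)"
  shows "\<beta> \<ge> 1" and "exp (real m / 2 * (1 - \<beta> + ln \<beta>)) \<le> \<delta>"
proof -
  define s where "s = sqrt (ln (1 / \<delta>) / real m)"
  have t: "ln (1 / \<delta>) \<ge> 0" using assms by simp
  then have s: "s \<ge> 0" "s\<^sup>2 = ln (1 / \<delta>) / real m" by (simp_all add: s_def)
  have \<beta>: "\<beta> = 1 + 2 * s + 2 * s\<^sup>2"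
    by (simp add: \<beta>_def zeta1_def s_def[symmetric] s(2))
  show ge: "\<beta> \<ge> 1" using s(1) by (simp add: \<beta>)
  have "\<beta> \<le> exp (2 * s)"
    using exp_lower_Taylor_quadratic[of "2 * s"] s by (simp add: \<beta> power_mult_distrib)
  then have "ln \<beta> \<le> ln (exp (2 * s))" using ge by (intro ln_mono) auto
  then have "ln \<beta> \<le> 2 * s" by simp
  then have "real m / 2 * (1 - \<beta> + ln \<beta>) \<le> real m / 2 * (- 2 * s\<^sup>2)"
    by (intro mult_left_mono) (simp_all add: \<beta>)
  also have "\<dots> = ln \<delta>" using assms by (simp add: s ln_div)
  finally show "exp (real m / 2 * (1 - \<beta> + ln \<beta>)) \<le> \<delta>"
    using assms by (metis exp_le_cancel_iff exp_ln)
qed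

text \<open>The difference of the two sides vanishes at 0 and has derivative
  \<open>x * (exp x - 1) \<ge> 0\<close>.\<close>

lemma exp_mult_one_minus_le:
  fixes a :: real
  assumes "a \<ge> 0"
  shows "exp a * (1 - a) \<le> 1 - a\<^sup>2 / 2"
proof -
  let ?g = "\<lambda>x::real. 1 - x\<^sup>2 / 2 - exp x * (1 - x)"
  have "?g 0 \<le> ?g a"
  proof (rule DERIV_nonneg_imp_nondecreasing[OF assms])
    fix x :: real assume "0 \<le> x"
    moreover have "(?g has_real_derivative x * (exp x - 1)) (at x)"
      by (auto intro!: derivative_eq_intros simp: algebra_simps)
    ultimately show "\<exists>y. (?g has_real_derivative y) (at x) \<and> 0 \<le> y"
      by (intro exI[of _ "x * (exp x - 1)"]) simp
  qed
  then show ?thesis by simp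
qed

text \<open>With \<open>u = \<delta> powr (2 / m)\<close> the claim is
  \<open>1 - \<beta> + ln \<beta> \<le> ln u\<close>, checked for each entry of the maximum. If
  \<open>\<beta> = u / exp 1\<close>, the left side is \<open>ln u - \<beta>\<close>. If
  \<open>\<beta> = 1 - a\<close> with \<open>a\<^sup>2 = 2 * (1 - u)\<close>, it is
  \<open>ln (exp a * (1 - a))\<close>, and
  \<open>exp a * (1 - a) \<le> 1 - a\<^sup>2 / 2 = u\<close>.\<close>

lemma lower_tail_exponent:
  fixes \<delta> :: real
  assumes "m \<ge> 1" "0 < \<delta>" "\<delta> < 1"
  defines "\<beta> \<equiv> inverse (zeta2 m \<delta>)"
  shows "0 < \<beta>" and "\<beta> \<le> 1" and "exp (real m / 2 * (1 - \<beta> + ln \<beta>)) \<le> \<delta>"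
proof -
  define u where "u = \<delta> powr (2 / real m)"
  have u: "0 < u" "u < 1"
    using assms powr_less_mono2[of "2 / real m" \<delta> 1] by (simp_all add: u_def)
  define a where "a = sqrt (2 * (1 - u))"
  have a: "a > 0" "a\<^sup>2 = 2 * (1 - u)" using u by (simp_all add: a_def)
  then have "1 - a\<^sup>2 / 2 = u" by (simp add: field_simps)
  have \<beta>: "\<beta> = max (1 / exp 1 * u) (1 - a)"
    by (simp add: \<beta>_def zeta2_def u_def a_def)
  \<comment> \<open>\<open>1 - a\<close> may be negative; the other entry keeps
    \<open>\<beta>\<close> positive.\<close>
  show pos: "0 < \<beta>" using u by (simp add: \<beta> less_max_iff_disj)
  have "u < exp 1" using u one_le_exp_iff[of 1] by (smt (verit))
  then show "\<beta> \<le> 1" using a(1) by (simp add: \<beta> field_simps)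
  have "1 - \<beta> + ln \<beta> \<le> ln u"
  proof (cases "1 / exp 1 * u \<le> 1 - a")
    case False
    then have "\<beta> = u / exp 1" by (simp add: \<beta>)
    then show ?thesis using pos u by (simp add: ln_div)
  next
    case True
    then have eq: "\<beta> = 1 - a" by (simp add: \<beta>)
    have "1 - \<beta> + ln \<beta> = ln (exp a * (1 - a))"
      using pos eq by (simp add: ln_mult)
    also have "\<dots> \<le> ln u"
      using exp_mult_one_minus_le[of a] a(1) pos eq \<open>1 - a\<^sup>2 / 2 = u\<close> by (intro ln_mono) auto
    finally show ?thesis .
  qed
  then have "real m / 2 * (1 - \<beta> + ln \<beta>) \<le> real m / 2 * ln u"
    by (intro mult_left_mono) simp_all
  also have "\<dots> = ln \<delta>" using assms by (simp add: u_def ln_powr)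
  finally show "exp (real m / 2 * (1 - \<beta> + ln \<beta>)) \<le> \<delta>"
    using assms by (metis exp_le_cancel_iff exp_ln)
qed

section \<open>The minimum over the classes and the union bound\<close>

text \<open>Alignment with factor \<open>1 / c\<close> changes the minimal norm for a single class
  by the factor \<open>c\<close>. The comparison holds for each class with the same constants, hence
  for the infimum.\<close>

lemma rstar_S_affine_clf_bounds:
  fixes W :: "nat \<Rightarrow> real^'n"
  assumes S: "subspace S" and c: "0 < c1" "0 < c2"
    and gap: "\<And>k. k < L \<Longrightarrow> k \<noteq> khat \<Longrightarrow> affine_clf W b k x0 < affine_clf W b khat x0"
    and W: "\<And>k. k < L \<Longrightarrow> k \<noteq> khat \<Longrightarrow> W k \<noteq> W khat"
    and lo: "\<And>k. k < L \<Longrightarrow> k \<noteq> khat \<Longrightarrow> \<not> aligned (1 / c1) (W k - W khat) S"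
    and hi: "\<And>k. k < L \<Longrightarrow> k \<noteq> khat \<Longrightarrow> aligned (1 / c2) (W k - W khat) S"
  shows "ereal c1 * rstar_S (affine_clf W b) L UNIV x0 khat \<le> rstar_S (affine_clf W b) L S x0 khat"
    and "rstar_S (affine_clf W b) L S x0 khat \<le> ereal c2 * rstar_S (affine_clf W b) L UNIV x0 khat"
proof -
  let ?K = "{..<L} - {khat}"
  let ?r = "rk_S (affine_clf W b) UNIV x0 khat" and ?rS = "rk_S (affine_clf W b) S x0 khat"
  have lo': "ereal c1 * ?r k \<le> ?rS k" if "k \<in> ?K" for k
    using rk_S_affine_clf_ge[of "1 / c1" W k khat S b x0] rk_S_affine_clf_UNIV[of W k khat b x0]
      that c lo W gap by (simp add: mult.commute)
  have hi': "?rS k \<le> ereal c2 * ?r k" if "k \<in> ?K" for k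
    using rk_S_affine_clf_le[OF S, of "1 / c2" W b k x0 khat] rk_S_affine_clf_UNIV[of W k khat b x0]
      that c hi W gap by (simp add: mult.commute)
  show "ereal c1 * rstar_S (affine_clf W b) L UNIV x0 khat \<le> rstar_S (affine_clf W b) L S x0 khat"
    unfolding rstar_S_def
  proof (rule INF_greatest)
    fix k assume k: "k \<in> ?K"
    have "ereal c1 * (INF k\<in>?K. ?r k) \<le> ereal c1 * ?r k"
      using c k by (intro ereal_mult_left_mono INF_lower) auto
    also have "\<dots> \<le> ?rS k" using k by (rule lo')
    finally show "ereal c1 * (INF k\<in>?K. ?r k) \<le> ?rS k" .
  qed
  show "rstar_S (affine_clf W b) L S x0 khat \<le> ereal c2 * rstar_S (affine_clf W b) L UNIV x0 khat"
  proof (cases "?K = {}")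
    case True
    \<comment> \<open>With no competing class both infima are \<open>\<infinity>\<close>, and
      multiplication by \<open>c2 > 0\<close> preserves this.\<close>
    show ?thesis unfolding rstar_S_def True using c by (simp add: top_ereal_def)
  next
    case False
    \<comment> \<open>The upper bound is applied at a class that attains the unrestricted
      minimum.\<close>
    then have "(INF k\<in>?K. ?r k) = Min (?r ` ?K)" by (intro Min_Inf[symmetric]) auto
    also have "\<dots> \<in> ?r ` ?K" using False by (intro Min_in) auto
    finally obtain k where k: "k \<in> ?K" "(INF k\<in>?K. ?r k) = ?r k" by blast
    have "(INF k\<in>?K. ?rS k) \<le> ?rS k" using k(1) by (rule INF_lower)
    also have "\<dots> \<le> ereal c2 * ?r k" using k(1) by (rule hi')
    finally show ?thesis by (simp add: rstar_S_def k(2))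
  qed
qed

theorem theorem1:
  fixes W :: "nat \<Rightarrow> real^'n" and b :: "nat \<Rightarrow> real" and x0 :: "real^'n"
    and L khat m :: nat and \<delta> :: real
  assumes "CARD('n) \<ge> 2" and "1 \<le> m" and "m < CARD('n)"
    and "0 < \<delta>" and "\<delta> < 1" and "khat < L"
    and "\<forall>k<L. k \<noteq> khat \<longrightarrow> affine_clf W b k x0 < affine_clf W b khat x0"
    and "\<forall>k<L. k \<noteq> khat \<longrightarrow> W k \<noteq> W khat"
  shows "\<exists>E \<in> sets (rand_dirs m :: (nat \<Rightarrow> real^'n) measure).
           measure (rand_dirs m) E \<ge> 1 - 2 * (real L + 1) * \<delta> \<and>
           (\<forall>v \<in> E.
              ereal (sqrt (zeta1 m \<delta>) * sqrt (real CARD('n) / real m))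
                * rstar_S (affine_clf W b) L UNIV x0 khat
              \<le> rstar_S (affine_clf W b) L (span (v ` {..<m})) x0 khat
            \<and> rstar_S (affine_clf W b) L (span (v ` {..<m})) x0 khat
              \<le> ereal (sqrt (zeta2 m \<delta>) * sqrt (real CARD('n) / real m))
                * rstar_S (affine_clf W b) L UNIV x0 khat)"
proof -
  define M where "M = (rand_dirs m :: (nat \<Rightarrow> real^'n) measure)"
  interpret prob_space M unfolding M_def by (rule prob_space_rand_dirs)
  define c1 c2 where "c1 = sqrt (zeta1 m \<delta>) * sqrt (real CARD('n) / real m)"
    and "c2 = sqrt (zeta2 m \<delta>) * sqrt (real CARD('n) / real m)"
  define \<beta>1 \<beta>2 where "\<beta>1 = inverse (zeta1 m \<delta>)" and "\<beta>2 = inverse (zeta2 m \<delta>)"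
  note up = upper_tail_exponent[OF assms(2,4,5), folded \<beta>1_def]
  note low = lower_tail_exponent[OF assms(2,4,5), folded \<beta>2_def]
  \<comment> \<open>The factors of the theorem are the reciprocals of the projection thresholds in
    the tail bounds.\<close>
  have inv: "1 / c1 = sqrt (\<beta>1 * real m / real CARD('n))" "1 / c2 = sqrt (\<beta>2 * real m / real CARD('n))"
    by (simp_all add: c1_def c2_def \<beta>1_def \<beta>2_def real_sqrt_mult real_sqrt_divide real_sqrt_inverse divide_simps)
  have z: "zeta1 m \<delta> > 0" "zeta2 m \<delta> > 0"
    using up(1) low(1) by (simp_all add: \<beta>1_def \<beta>2_def one_le_inverse_iff)
  have c: "c1 > 0" "c2 > 0" using z assms(2) by (simp_all add: c1_def c2_def)
  define K where "K = {..<L} - {khat}"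
  \<comment> \<open>Bad events: on \<open>U k\<close> the projection is too long for the lower
    bound, on \<open>D k\<close> too short for the upper bound. Each has probability at most
    \<delta>.\<close>
  define U where "U k = {v \<in> space M. aligned (1 / c1) (W k - W khat) (span (v ` {..<m}))}" for k
  define D where "D k = {v \<in> space M. \<not> aligned (1 / c2) (W k - W khat) (span (v ` {..<m}))}" for k
  have sets: "U k \<in> events" "D k \<in> events" for k
    unfolding U_def D_def M_def by (intro sets.sets_Collect_neg sets_rand_dirs_aligned)+
  have probs: "prob (U k \<union> D k) \<le> 2 * \<delta>" if "k \<in> K" for k
  proof -
    have z: "W k - W khat \<noteq> 0" using that assms(8) by (auto simp: K_def)
    have "prob (U k) \<le> \<delta>"
      using rand_dirs_upper_tail[OF z assms(3), of \<beta>1] up by (simp add: U_def M_def inv)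
    moreover have "prob (D k) \<le> \<delta>"
      using rand_dirs_lower_tail[OF z assms(3), of \<beta>2] low by (simp add: D_def M_def inv)
    ultimately show ?thesis using measure_Un_le[OF sets, of k k] by simp
  qed
  define E where "E = space M - (\<Union>k\<in>K. U k \<union> D k)"
  have K: "finite K" "card K \<le> L" by (auto simp: K_def intro: order.trans[OF card_Diff1_le])
  have E: "E \<in> events" unfolding E_def using sets K by auto
  have "prob (\<Union>k\<in>K. U k \<union> D k) \<le> (\<Sum>k\<in>K. prob (U k \<union> D k))"
    using sets K by (intro finite_measure_subadditive_finite) auto
  also have "\<dots> \<le> real (card K) * (2 * \<delta>)" using probs by (intro sum_bounded_above) auto
  \<comment> \<open>The number of competing classes is estimated by \<open>L\<close>, then by
    \<open>L + 1\<close>.\<close>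
  also have "\<dots> \<le> (real L + 1) * (2 * \<delta>)" using K(2) assms(4) by (intro mult_right_mono) auto
  finally have "prob E \<ge> 1 - 2 * (real L + 1) * \<delta>"
    unfolding E_def using sets K by (subst prob_compl) (auto simp: algebra_simps)
  moreover have "ereal c1 * rstar_S (affine_clf W b) L UNIV x0 khat
        \<le> rstar_S (affine_clf W b) L (span (v ` {..<m})) x0 khat
      \<and> rstar_S (affine_clf W b) L (span (v ` {..<m})) x0 khat
        \<le> ereal c2 * rstar_S (affine_clf W b) L UNIV x0 khat" if "v \<in> E" for v
  proof -
    have "\<not> aligned (1 / c1) (W k - W khat) (span (v ` {..<m}))"
      "aligned (1 / c2) (W k - W khat) (span (v ` {..<m}))" if "k < L" "k \<noteq> khat" for k
      using \<open>v \<in> E\<close> that unfolding E_def U_def D_def K_def by blast+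
    then show ?thesis
      using assms(7,8) c by (intro conjI rstar_S_affine_clf_bounds[where ?c1.0=c1 and ?c2.0=c2]) auto
  qed
  ultimately show ?thesis
    using E unfolding M_def c1_def c2_def by blast
qed

end
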